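(* For every integer $n\ge 1$ there exists a finite constant $c_n$, depending only on $n$, such that the following holds. Let $N$ be a positive integer and $a>0$, and consider a motion of $N$ identical hard spheres of radius $a$ and unit mass in the whole space $\mathbb{R}^n$, with elastic, frictionless collisions. Assume that the set of collisions is finite on every band $(0,\tau)\times\mathbb{R}^n$ ($\tau>0$), and that the motion involves only binary collisions. Let $\bar v$ be the root mean square velocity of the system. Then $$\sum_{\mathrm{kinks}}\bigl(\bar v\,|v'-v|+|v\wedge v'|\bigr)\le c_nN^2\bar v^2,$$ where the sum runs over all particles and all the collisions they experience (in times $t>0$), and where, for a given particle and a given collision it experiences, $v$ and $v'$ denote the velocities of that particle just before and just after the collision.
   Context: Dynamics. The particles $P_\alpha$, $1\le\alpha\le N$, are spheres of radius $a>0$ and mass $1$ in $\mathbb{R}^n$, with centers $y_\alpha(t)$ and velocities $v_\alpha(t)\in\mathbb{R}^n$; distinct centers always satisfy $|y_\alpha-y_\beta|\ge 2a$. The velocity of each particle is constant between its consecutive collisions, so trajectories are polygonal chains. A collision between $P_\alpha$ and $P_\beta$ occurs when $|y_\beta-y_\alpha|=2a$ and the velocities $v_\alpha,v_\beta$ before and $v'_\alpha,v'_\beta$ after satisfy $$(v_\beta-v_\alpha)\cdot(y_\beta-y_\alpha)<0,\qquad (v'_\beta-v'_\alpha)\cdot(y_\beta-y_\alpha)>0.$$ At a binary collision: (i) momentum is conserved, $v'_\alpha+v'_\beta=v_\alpha+v_\beta$; (ii) the collision is frictionless, $v'_\alpha-v_\alpha=v_\beta-v'_\beta$ is parallel to $y_\beta-y_\alpha$;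 (iii) kinetic energy is conserved, $|v'_\alpha|^2+|v'_\beta|^2=|v_\alpha|^2+|v_\beta|^2$. "Only binary collisions" means that every collision involves exactly two particles. A kink is a pair consisting of a particle and a collision this particle experiences (so each binary collision produces two kinks). The total energy $E=\sum_\alpha\frac12|v_\alpha(t)|^2$ is constant in time, and $\bar v:=\sqrt{2E/N}$. For $v,v'\in\mathbb{R}^n$, $|v\wedge v'|=\sqrt{|v|^2|v'|^2-(v\cdot v')^2}$. *)

theory Defs
  imports "HOL-Analysis.Analysis"
begin

text \<open>
  A motion of \<open>N\<close> particles is given by the trajectories of the centers,
  \<open>y \<alpha> t\<close> for \<open>\<alpha> \<in> {1..N}\<close> and \<open>t > 0\<close>; values at other arguments are irrelevant.
  The velocities just before and just after an instant are the one-sided derivatives of the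
  trajectory. They exist at every \<open>t > 0\<close> for the motions considered here, since the
  trajectories are continuous and affine between the (locally finitely many) collisions.
\<close>

definition vel_before :: "(real \<Rightarrow> real ^ 'n) \<Rightarrow> real \<Rightarrow> real ^ 'n" where
  "vel_before x t = vector_derivative x (at_left t)"

definition vel_after :: "(real \<Rightarrow> real ^ 'n) \<Rightarrow> real \<Rightarrow> real ^ 'n" where
  "vel_after x t = vector_derivative x (at_right t)"

definition wedge_norm :: "real ^ 'n \<Rightarrow> real ^ 'n \<Rightarrow> real" where
  "wedge_norm v w = sqrt ((norm v)\<^sup>2 * (norm w)\<^sup>2 - (v \<bullet> w)\<^sup>2)"

definition collide :: "nat \<Rightarrow> real \<Rightarrow> (nat \<Rightarrow> real \<Rightarrow> real ^ 'n) \<Rightarrow> real \<Rightarrow> nat \<Rightarrow> nat \<Rightarrow> bool" where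
  "collide N a y t \<alpha> \<beta> \<longleftrightarrow>
     t > 0 \<and> \<alpha> \<in> {1..N} \<and> \<beta> \<in> {1..N} \<and> \<alpha> \<noteq> \<beta> \<and>
     norm (y \<beta> t - y \<alpha> t) = 2 * a \<and>
     (vel_before (y \<beta>) t - vel_before (y \<alpha>) t) \<bullet> (y \<beta> t - y \<alpha> t) < 0 \<and>
     (vel_after (y \<beta>) t - vel_after (y \<alpha>) t) \<bullet> (y \<beta> t - y \<alpha> t) > 0"

definition binary_collision ::
    "nat \<Rightarrow> real \<Rightarrow> (nat \<Rightarrow> real \<Rightarrow> real ^ 'n) \<Rightarrow> real \<Rightarrow> nat \<Rightarrow> nat \<Rightarrow> bool" where
  "binary_collision N a y t \<alpha> \<beta> \<longleftrightarrow>
     collide N a y t \<alpha> \<beta> \<and>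
     (\<forall>\<gamma>. \<gamma> \<noteq> \<alpha> \<longrightarrow> \<gamma> \<noteq> \<beta> \<longrightarrow> \<not> collide N a y t \<alpha> \<gamma> \<and> \<not> collide N a y t \<beta> \<gamma>)"

definition collision_law :: "(nat \<Rightarrow> real \<Rightarrow> real ^ 'n) \<Rightarrow> real \<Rightarrow> nat \<Rightarrow> nat \<Rightarrow> bool" where
  "collision_law y t \<alpha> \<beta> \<longleftrightarrow>
     vel_after (y \<alpha>) t + vel_after (y \<beta>) t = vel_before (y \<alpha>) t + vel_before (y \<beta>) t \<and>
     (\<exists>k. vel_after (y \<alpha>) t - vel_before (y \<alpha>) t = k *\<^sub>R (y \<beta> t - y \<alpha> t)) \<and>
     (norm (vel_after (y \<alpha>) t))\<^sup>2 + (norm (vel_after (y \<beta>) t))\<^sup>2 =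
     (norm (vel_before (y \<alpha>) t))\<^sup>2 + (norm (vel_before (y \<beta>) t))\<^sup>2"

definition hard_sphere_motion :: "nat \<Rightarrow> real \<Rightarrow> (nat \<Rightarrow> real \<Rightarrow> real ^ 'n) \<Rightarrow> bool" where
  "hard_sphere_motion N a y \<longleftrightarrow>
     (\<forall>\<alpha>\<in>{1..N}. continuous_on {0<..} (y \<alpha>)) \<and>
     (\<forall>\<alpha>\<in>{1..N}. \<forall>\<beta>\<in>{1..N}. \<alpha> \<noteq> \<beta> \<longrightarrow> (\<forall>t>0. norm (y \<alpha> t - y \<beta> t) \<ge> 2 * a)) \<and>
     (\<forall>\<alpha>\<in>{1..N}. \<forall>s\<ge>0. \<forall>t>s. (\<forall>r\<in>{s<..<t}. \<forall>\<beta>. \<not> collide N a y r \<alpha> \<beta>) \<longrightarrow>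
        (\<exists>v. \<forall>r\<in>{s<..<t}. (y \<alpha> has_vector_derivative v) (at r))) \<and>
     (\<forall>t \<alpha> \<beta>. binary_collision N a y t \<alpha> \<beta> \<longrightarrow> collision_law y t \<alpha> \<beta>)"

definition only_binary_collisions ::
    "nat \<Rightarrow> real \<Rightarrow> (nat \<Rightarrow> real \<Rightarrow> real ^ 'n) \<Rightarrow> bool" where
  "only_binary_collisions N a y \<longleftrightarrow>
     (\<forall>t \<alpha> \<beta>. collide N a y t \<alpha> \<beta> \<longrightarrow> binary_collision N a y t \<alpha> \<beta>)"

text \<open>A collision is recorded by its time and the unordered pair of particles involved.\<close>

definition collisions :: "nat \<Rightarrow> real \<Rightarrow> (nat \<Rightarrow> real \<Rightarrow> real ^ 'n) \<Rightarrow> (real \<times> nat set) set" where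
  "collisions N a y = {(t, {\<alpha>, \<beta>}) | t \<alpha> \<beta>. collide N a y t \<alpha> \<beta>}"

definition locally_finite_collisions ::
    "nat \<Rightarrow> real \<Rightarrow> (nat \<Rightarrow> real \<Rightarrow> real ^ 'n) \<Rightarrow> bool" where
  "locally_finite_collisions N a y \<longleftrightarrow>
     (\<forall>\<tau>>0. finite {(t, S) \<in> collisions N a y. 0 < t \<and> t < \<tau>})"

definition kinks :: "nat \<Rightarrow> real \<Rightarrow> (nat \<Rightarrow> real \<Rightarrow> real ^ 'n) \<Rightarrow> (nat \<times> real \<times> nat set) set" where
  "kinks N a y = {(\<alpha>, t, S). (t, S) \<in> collisions N a y \<and> \<alpha> \<in> S}"

text \<open>
  At a collision instant the velocity is read just after the collision; since the energy is
  conserved, neither this convention nor the time \<open>t > 0\<close> affects the value.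
\<close>

definition total_energy :: "nat \<Rightarrow> (nat \<Rightarrow> real \<Rightarrow> real ^ 'n) \<Rightarrow> real \<Rightarrow> real" where
  "total_energy N y t = (\<Sum>\<alpha>\<in>{1..N}. 1 / 2 * (norm (vel_after (y \<alpha>) t))\<^sup>2)"

definition rms_velocity :: "nat \<Rightarrow> (nat \<Rightarrow> real \<Rightarrow> real ^ 'n) \<Rightarrow> real \<Rightarrow> real" where
  "rms_velocity N y t = sqrt (2 * total_energy N y t / real N)"

definition kink_weight :: "real \<Rightarrow> (nat \<Rightarrow> real \<Rightarrow> real ^ 'n) \<Rightarrow> nat \<times> real \<times> nat set \<Rightarrow> real" where
  "kink_weight vbar y = (\<lambda>(\<alpha>, t, S).
     vbar * norm (vel_after (y \<alpha>) t - vel_before (y \<alpha>) t) +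
     wedge_norm (vel_before (y \<alpha>) t) (vel_after (y \<alpha>) t))"

end

theory Submission
  imports Defs
begin

text \<open>
  In space-time with coordinates \<open>(vbar t, y)\<close> the trajectories form a framework in tension: an
  edge of a trajectory pulls with the force \<open>V = (vbar, v)\<close>, and the momentum exchanged in a
  collision is the tension of the segment between the two centers, because the contact force is
  repulsive. All nodes are in equilibrium. This survives projection to any two coordinates, and
  the quantities \<open>vbar * \<bar>v' - v\<bar>\<close> and \<open>\<bar>v \<and> v'\<bar>\<close> are controlled by the wedge products of the
  projections of \<open>V\<close> and \<open>V'\<close>.

  A planar framework in tension is the reciprocal diagram of a convex function, and the wedge
  products at the nodes are areas of its subdifferentials, so they add up to at most the
  square of the total force in the edges that go to infinity, which here is \<open>O(N vbar)\<close>. The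
  area bound is obtained by a sweep: the sum of \<open>w w' \<bar>y - y'\<bar>\<close> over all pairs of edges that
  cross a vertical line is a convex function of the position of the line, and at each node its
  slope increases by the wedge products of the pairs of edges that meet there from the same side.
\<close>

section \<open>Sweeping a planar framework by parallel lines\<close>

text \<open>Both sums are grouped by the value of \<open>k\<close>, and \<open>f\<close> is constant
  on each group. With \<open>k\<close> the height on a vertical line, balance at each point extends
  to every weight that depends on the height alone.\<close>

lemma sum_fibre_cong:
  fixes g :: "'e \<Rightarrow> real" and f :: "'b \<Rightarrow> real"
  assumes "finite A" "finite B"
    and "\<And>h. (\<Sum>e\<in>{e\<in>A. k e = h}. g e) = (\<Sum>e\<in>{e\<in>B. k e = h}. g e)"
  shows "(\<Sum>e\<in>A. f (k e) * g e) = (\<Sum>e\<in>B. f (k e) * g e)"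
proof -
  have fib: "(\<Sum>e\<in>S. f (k e) * g e) = (\<Sum>h\<in>k ` (A \<union> B). f h * (\<Sum>e\<in>{e\<in>S. k e = h}. g e))"
    if "S \<subseteq> A \<union> B" for S
  proof -
    have "finite S" using that assms(1,2) finite_subset by blast
    then have "(\<Sum>e\<in>S. f (k e) * g e) = (\<Sum>h\<in>k ` (A \<union> B). \<Sum>e\<in>{e\<in>S. k e = h}. f (k e) * g e)"
      using assms(1,2) that by (intro sum.group[symmetric]) auto
    also have "\<dots> = (\<Sum>h\<in>k ` (A \<union> B). f h * (\<Sum>e\<in>{e\<in>S. k e = h}. g e))"
      by (intro sum.cong refl) (simp add: sum_distrib_left)
    finally show ?thesis .
  qed
  show ?thesis using fib[of A] fib[of B] assms(3) by simp
qed

text \<open>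
  Edge \<open>e\<close> is the piece of the line \<open>y = m e * x + c e\<close> over \<open>l e < x < r e\<close> and carries the
  force \<open>w e * (1, m e)\<close>; it is absent if \<open>l e \<ge> r e\<close>.
\<close>

locale sweep =
  fixes K :: "'e set" and l r m c w :: "'e \<Rightarrow> real"
  assumes finK: "finite K" and w_nonneg: "\<And>e. e \<in> K \<Longrightarrow> w e \<ge> 0"
begin

definition ht :: "'e \<Rightarrow> real \<Rightarrow> real" where "ht e s = m e * s + c e"

text \<open>The half-open conditions make an edge that ends on the line count only in
  \<open>before\<close>, one that starts there only in \<open>after\<close>, and one that passes
  through in both.\<close>

definition before :: "real \<Rightarrow> 'e set" where "before s = {e\<in>K. l e < s \<and> s \<le> r e}"

definition after :: "real \<Rightarrow> 'e set" where "after s = {e\<in>K. l e \<le> s \<and> s < r e}"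

definition pair :: "'e \<Rightarrow> 'e \<Rightarrow> real" where "pair e e' = w e * w e' * \<bar>m e' - m e\<bar>"

text \<open>
  For \<open>\<sigma> = -1\<close> and \<open>\<sigma> = 1\<close> these are the left and right derivatives at \<open>s\<close> of
  \<open>w e * w e' * \<bar>ht e' s - ht e s\<bar>\<close>.
\<close>

definition turn :: "real \<Rightarrow> real \<Rightarrow> 'e \<Rightarrow> 'e \<Rightarrow> real" where
  "turn \<sigma> s e e' = w e * w e' *
     (if ht e s = ht e' s then \<sigma> * \<bar>m e' - m e\<bar> else (m e' - m e) * sgn (ht e' s - ht e s))"

text \<open>For \<open>before s\<close> with \<open>\<sigma> = -1\<close> and \<open>after s\<close>
  with \<open>\<sigma> = 1\<close> this is the left and right derivative at \<open>s\<close> of the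
  convex function of the sweep. Pairs are ordered.\<close>

definition interaction :: "real \<Rightarrow> real \<Rightarrow> 'e set \<Rightarrow> real" where
  "interaction \<sigma> s S = (\<Sum>e\<in>S. \<Sum>e'\<in>S. turn \<sigma> s e e')"

definition meet :: "real \<Rightarrow> 'e set \<Rightarrow> 'e \<Rightarrow> 'e \<Rightarrow> real" where
  "meet s S e e' = (if e \<in> S \<and> e' \<in> S \<and> ht e s = ht e' s then pair e e' else 0)"

text \<open>Two edges that cross on the line at interior points count twice, since
  \<open>turn\<close> jumps from \<open>- pair e e'\<close> to \<open>pair e e'\<close>.\<close>

definition gain :: "real \<Rightarrow> 'e \<Rightarrow> 'e \<Rightarrow> real" where
  "gain s e e' = meet s (before s) e e' + meet s (after s) e e'"

text \<open>The components of the force are \<open>w e\<close> and \<open>w e * m e\<close>, so this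
  is equilibrium at every point \<open>(s, h)\<close> of the vertical line.\<close>

definition balanced :: "real \<Rightarrow> bool" where
  "balanced s \<longleftrightarrow> (\<forall>h.
     (\<Sum>e\<in>{e\<in>before s. ht e s = h}. w e) = (\<Sum>e\<in>{e\<in>after s. ht e s = h}. w e) \<and>
     (\<Sum>e\<in>{e\<in>before s. ht e s = h}. w e * m e) = (\<Sum>e\<in>{e\<in>after s. ht e s = h}. w e * m e))"

lemma before_sub: "before s \<subseteq> K" and after_sub: "after s \<subseteq> K"
  by (auto simp: before_def after_def)

lemma fin_before [simp]: "finite (before s)" and fin_after [simp]: "finite (after s)"
  using finK by (auto simp: before_def after_def)

lemma pair_nonneg: "e \<in> K \<Longrightarrow> e' \<in> K \<Longrightarrow> pair e e' \<ge> 0"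
  by (simp add: pair_def w_nonneg)

lemma meet_nonneg: "S \<subseteq> K \<Longrightarrow> meet s S e e' \<ge> 0"
  by (auto simp: meet_def intro!: pair_nonneg)

lemma gain_nonneg: "gain s e e' \<ge> 0"
  by (simp add: gain_def meet_nonneg before_sub after_sub)

text \<open>The pairs that meet on the line, which enter with the sign \<open>\<sigma>\<close>, are
  separated from a bilinear expression that sees an edge only through its height and force
  components. These are the data that \<open>balanced\<close> controls.\<close>

lemma interaction_split:
  assumes "S \<subseteq> K"
  shows "interaction \<sigma> s S = \<sigma> * (\<Sum>e\<in>K. \<Sum>e'\<in>K. meet s S e e') +
    (\<Sum>e\<in>S. \<Sum>e'\<in>S. sgn (ht e' s - ht e s) * (w e * (w e' * m e') - w e * m e * w e'))"
proof -
  have "(\<Sum>e\<in>K. \<Sum>e'\<in>K. meet s S e e') = (\<Sum>e\<in>S. \<Sum>e'\<in>S. meet s S e e')"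
    unfolding sum.cartesian_product using assms finK
    by (intro sum.mono_neutral_right) (auto simp: meet_def split: if_splits)
  moreover have "turn \<sigma> s e e' = \<sigma> * meet s S e e' +
      sgn (ht e' s - ht e s) * (w e * (w e' * m e') - w e * m e * w e')"
    if "e \<in> S" "e' \<in> S" for e e'
    using that by (auto simp: turn_def meet_def pair_def algebra_simps)
  ultimately show ?thesis
    unfolding interaction_def by (simp add: sum.distrib sum_distrib_left)
qed

text \<open>Balance gives the bilinear part of \<open>interaction_split\<close> the same value on
  both sides of the line. Only the meeting pairs remain, with sign 1 on the right and -1 on the
  left, so the difference adds them up.\<close>

lemma jump:
  assumes "balanced s"
  shows "interaction 1 s (after s) - interaction (-1) s (before s) = (\<Sum>e\<in>K. \<Sum>e'\<in>K. gain s e e')"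
proof -
  note fin = fin_before[of s] fin_after[of s]
  have bw: "(\<Sum>e\<in>before s. f (ht e s) * w e) = (\<Sum>e\<in>after s. f (ht e s) * w e)"
    and bm: "(\<Sum>e\<in>before s. f (ht e s) * (w e * m e)) = (\<Sum>e\<in>after s. f (ht e s) * (w e * m e))"
    for f :: "real \<Rightarrow> real"
    using assms unfolding balanced_def
    by (intro sum_fibre_cong[OF fin, where k = "\<lambda>e. ht e s"], blast)+
  have main: "(\<Sum>e\<in>before s. \<Sum>e'\<in>before s. sgn (ht e' s - ht e s) * (g e * g' e'))
     = (\<Sum>e\<in>after s. \<Sum>e'\<in>after s. sgn (ht e' s - ht e s) * (g e * g' e'))"
    if g: "\<And>f::real\<Rightarrow>real. (\<Sum>e\<in>before s. f (ht e s) * g e) = (\<Sum>e\<in>after s. f (ht e s) * g e)"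
      and g': "\<And>f::real\<Rightarrow>real. (\<Sum>e\<in>before s. f (ht e s) * g' e) = (\<Sum>e\<in>after s. f (ht e s) * g' e)"
    for g g' :: "'e \<Rightarrow> real"
  proof -
    have "(\<Sum>e\<in>S. \<Sum>e'\<in>S. sgn (ht e' s - ht e s) * (g e * g' e'))
        = (\<Sum>e\<in>S. (\<Sum>e'\<in>S. sgn (ht e' s - ht e s) * g' e') * g e)" for S
      by (simp add: sum_distrib_right sum_distrib_left mult_ac)
    then show ?thesis
      \<comment> \<open>The two sums pass from \<open>before s\<close> to \<open>after s\<close> one
        at a time: \<open>g\<close> is used with the whole inner sum as a function of the height,
        \<open>g'\<close> with the sign at a fixed height.\<close>
      using g[of "\<lambda>h. \<Sum>e'\<in>before s. sgn (ht e' s - h) * g' e'"] g'[of "\<lambda>h'. sgn (h' - _)"]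
      by simp
  qed
  have "(\<Sum>e\<in>before s. \<Sum>e'\<in>before s. sgn (ht e' s - ht e s) * (w e * (w e' * m e') - w e * m e * w e'))
     = (\<Sum>e\<in>after s. \<Sum>e'\<in>after s. sgn (ht e' s - ht e s) * (w e * (w e' * m e') - w e * m e * w e'))"
    using main[OF bw bm] main[OF bm bw]
    by (simp add: right_diff_distrib sum_subtractf)
  then show ?thesis
    by (simp add: interaction_split before_sub after_sub gain_def sum.distrib)
qed

text \<open>This is convexity of the absolute value of an affine function: a right derivative is at
  most the left derivative at any later point.\<close>

lemma turn_mono:
  assumes "e \<in> K" "e' \<in> K" "s < t"
  shows "turn 1 s e e' \<le> turn (-1) t e e'"
proof -
  define d where "d = m e' - m e"
  define b where "b = c e' - c e"
  have h: "ht e' u - ht e u = d * u + b" for u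
    by (simp add: ht_def d_def b_def algebra_simps)
  have eq: "ht e u = ht e' u \<longleftrightarrow> d * u + b = 0" for u
    using h[of u] by auto
  have sgn_mono: "(if x = 0 then \<bar>d\<bar> else d * sgn x) \<le> (if y = 0 then -\<bar>d\<bar> else d * sgn y)"
    if "d > 0 \<Longrightarrow> x < y" "d < 0 \<Longrightarrow> y < x" for x y :: real
    using that by (cases d "0::real" rule: linorder_cases) (auto simp: sgn_if split: if_splits)
  have "(if d * s + b = 0 then \<bar>d\<bar> else d * sgn (d * s + b))
      \<le> (if d * t + b = 0 then -\<bar>d\<bar> else d * sgn (d * t + b))"
    using assms(3) by (intro sgn_mono) auto
  then show ?thesis
    unfolding turn_def eq h d_def[symmetric] using assms w_nonneg
    by (intro mult_left_mono) auto
qed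

text \<open>As no edge starts or ends strictly between \<open>s\<close> and \<open>t\<close>, the
  same edges cross both lines, and \<open>turn_mono\<close> applies pair by pair.\<close>

lemma interaction_mono:
  assumes "s < t" "\<And>e. e \<in> K \<Longrightarrow> l e \<notin> {s<..<t} \<and> r e \<notin> {s<..<t}"
  shows "interaction 1 s (after s) \<le> interaction (-1) t (before t)"
proof -
  have "after s = before t"
    using assms by (force simp: after_def before_def)
  then show ?thesis
    unfolding interaction_def using before_sub[of t]
    by (auto intro!: sum_mono turn_mono assms(1))
qed

text \<open>The slope does not decrease between consecutive positions in \<open>C\<close>. The
  induction removes the largest position, which becomes the right end of the shorter
  interval.\<close>

lemma telescope:
  assumes "finite C" "\<And>s. s \<in> C \<Longrightarrow> a < s \<and> s < b" "a < b"
    "\<And>e. e \<in> K \<Longrightarrow> l e \<notin> {a<..<b} - C \<and> r e \<notin> {a<..<b} - C"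
  shows "interaction 1 a (after a) +
     (\<Sum>s\<in>C. interaction 1 s (after s) - interaction (-1) s (before s)) \<le> interaction (-1) b (before b)"
  using assms
proof (induction C arbitrary: b rule: finite_linorder_max_induct)
  case empty
  then show ?case using interaction_mono[of a b] by auto
next
  case (insert x C)
  have "interaction 1 a (after a) +
     (\<Sum>s\<in>C. interaction 1 s (after s) - interaction (-1) s (before s)) \<le> interaction (-1) x (before x)"
  proof (rule insert.IH)
    fix e assume "e \<in> K"
    then show "l e \<notin> {a<..<x} - C \<and> r e \<notin> {a<..<x} - C"
      using insert.prems(1)[of x] insert.prems(3)[of e] by auto
  qed (use insert in auto)
  moreover have "interaction 1 x (after x) \<le> interaction (-1) b (before b)"
  proof (rule interaction_mono)
    fix e assume "e \<in> K"
    have "C \<inter> {x<..<b} = {}" using insert.hyps(2) by auto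
    then show "l e \<notin> {x<..<b} \<and> r e \<notin> {x<..<b}"
      using insert.prems(1)[of x] insert.prems(3)[OF \<open>e \<in> K\<close>] by auto
  qed (use insert in auto)
  moreover have "x \<notin> C" using insert.hyps(2) by auto
  ultimately show ?case using insert.hyps(1) by (simp add: algebra_simps)
qed

lemma abs_interaction_le:
  assumes "\<bar>\<sigma>\<bar> = 1" "S \<subseteq> K"
  shows "\<bar>interaction \<sigma> s S\<bar> \<le> (\<Sum>e\<in>S. \<Sum>e'\<in>S. pair e e')"
proof -
  have "\<bar>turn \<sigma> s e e'\<bar> \<le> pair e e'" if "e \<in> S" "e' \<in> S" for e e'
  proof -
    have "w e \<ge> 0" "w e' \<ge> 0" using that assms w_nonneg by auto
    then show ?thesis
      using assms(1) by (auto simp: turn_def pair_def abs_mult sgn_if)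
  qed
  then show ?thesis
    unfolding interaction_def
    by (intro order_trans[OF sum_abs] sum_mono order_trans[OF sum_abs]) auto
qed

text \<open>Distinct indices select distinct ordered pairs of edges, and the gains that are not
  selected are nonnegative.\<close>

lemma sum_gain_le:
  assumes "finite C" "inj_on (\<lambda>i. (f i, g i)) I"
    and "\<And>i. i \<in> I \<Longrightarrow> f i \<in> K \<and> g i \<in> K \<and> s i \<in> C"
  shows "(\<Sum>i\<in>I. gain (s i) (f i) (g i)) \<le> (\<Sum>s\<in>C. \<Sum>e\<in>K. \<Sum>e'\<in>K. gain s e e')"
proof -
  let ?h = "\<lambda>i. (s i, f i, g i)"
  have "inj_on ?h I" using assms(2) by (auto simp: inj_on_def)
  then have "(\<Sum>i\<in>I. gain (s i) (f i) (g i)) = (\<Sum>(s, e, e')\<in>?h ` I. gain s e e')"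
    by (simp add: sum.reindex)
  also have "\<dots> \<le> (\<Sum>(s, e, e')\<in>C \<times> K \<times> K. gain s e e')"
    using assms finK by (intro sum_mono2) (auto simp: gain_nonneg)
  finally show ?thesis by (simp add: sum.cartesian_product)
qed

text \<open>By \<open>jump\<close> the gains are the increments of the slope at the nodes; by
  \<open>telescope\<close> they add up to at most the final slope minus the initial one. Each of
  these is bounded by the pairs that cross the border.\<close>

theorem total_gain:
  assumes "finite C" "\<And>s. s \<in> C \<Longrightarrow> a < s \<and> s < b \<and> balanced s" "a < b"
    "\<And>e. e \<in> K \<Longrightarrow> l e \<notin> {a<..<b} - C \<and> r e \<notin> {a<..<b} - C"
  shows "(\<Sum>s\<in>C. \<Sum>e\<in>K. \<Sum>e'\<in>K. gain s e e') \<le>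
    (\<Sum>e\<in>after a. \<Sum>e'\<in>after a. pair e e') + (\<Sum>e\<in>before b. \<Sum>e'\<in>before b. pair e e')"
proof -
  have "(\<Sum>s\<in>C. interaction 1 s (after s) - interaction (-1) s (before s))
      = (\<Sum>s\<in>C. \<Sum>e\<in>K. \<Sum>e'\<in>K. gain s e e')"
    using assms(2) by (intro sum.cong refl jump) auto
  then show ?thesis
    using telescope[of C a b] assms abs_interaction_le[of 1 "after a" a]
      abs_interaction_le[of "-1" "before b" b] after_sub before_sub by fastforce
qed

end

section \<open>Frameworks given by segments with two labelled ends\<close>

locale segments =
  fixes K :: "'e set" and px py qx qy fx fy lam :: "'e \<Rightarrow> real"
  assumes finite_K: "finite K"
    and lam_nonneg: "e \<in> K \<Longrightarrow> lam e \<ge> 0"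
    and fx_eq: "e \<in> K \<Longrightarrow> fx e = lam e * (qx e - px e)"
    and fy_eq: "e \<in> K \<Longrightarrow> fy e = lam e * (qy e - py e)"
    and nonvertical: "e \<in> K \<Longrightarrow> fx e = 0 \<Longrightarrow> fy e = 0"
begin

definition "left e = min (px e) (qx e)"
definition "right e = max (px e) (qx e)"
text \<open>The slope is read off the force. For \<open>fx e = 0\<close> it is 0 by the convention
  for division; such an edge has weight 0 in the sweep, and by \<open>nonvertical\<close> it carries
  no force.\<close>

definition "slope e = fy e / fx e"
definition "offset e = py e - slope e * px e"

sublocale sweep K left right slope offset "\<lambda>e. \<bar>fx e\<bar>"
  by unfold_locales (auto simp: finite_K)

lemma ht_px: "ht e (px e) = py e"
  by (simp add: ht_def offset_def)

lemma ht_qx: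
  assumes "e \<in> K" "fx e \<noteq> 0"
  shows "ht e (qx e) = qy e"
proof -
  have "lam e \<noteq> 0" using assms fx_eq by auto
  then have "slope e * (qx e - px e) = qy e - py e"
    using assms by (simp add: slope_def fx_eq fy_eq)
  then show ?thesis by (simp add: ht_def offset_def algebra_simps)
qed

text \<open>Under tension, \<open>lam e \<ge> 0\<close>, the force at \<open>p\<close> points to
  \<open>q\<close>, so the sign of \<open>fx e\<close> tells which end is on the left.\<close>

lemma fx_pos: "e \<in> K \<Longrightarrow> fx e > 0 \<Longrightarrow> px e < qx e"
  and fx_neg: "e \<in> K \<Longrightarrow> fx e < 0 \<Longrightarrow> qx e < px e"
  using lam_nonneg[of e] fx_eq[of e] by (auto simp: zero_less_mult_iff mult_less_0_iff)

lemma pair_eq: "e \<in> K \<Longrightarrow> e' \<in> K \<Longrightarrow> pair e e' = \<bar>fx e * fy e' - fy e * fx e'\<bar>"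
proof -
  assume e: "e \<in> K" "e' \<in> K"
  have "pair e e' = \<bar>fx e * fx e' * (slope e' - slope e)\<bar>"
    by (simp add: pair_def abs_mult)
  also have "fx e * fx e' * (slope e' - slope e) = fx e * fy e' - fy e * fx e'"
    using nonvertical e by (cases "fx e = 0"; cases "fx e' = 0") (auto simp: slope_def field_simps)
  finally show ?thesis .
qed

text \<open>
  A segment pulls its end \<open>p\<close> with force \<open>f\<close> and its end \<open>q\<close> with force \<open>-f\<close>.
\<close>

lemma balancedI:
  assumes "\<And>h. (\<Sum>e\<in>K. (if px e = s \<and> py e = h then fx e else 0) - (if qx e = s \<and> qy e = h then fx e else 0)) = 0"
    and "\<And>h. (\<Sum>e\<in>K. (if px e = s \<and> py e = h then fy e else 0) - (if qx e = s \<and> qy e = h then fy e else 0)) = 0"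
  shows "balanced s"
proof -
  \<comment> \<open>The end \<open>p\<close> is the left one if \<open>fx e > 0\<close> and the
    right one if \<open>fx e < 0\<close>. The factor \<open>sgn (fx e)\<close> compensates for this
    and turns the ends \<open>p\<close> and \<open>q\<close> into \<open>after\<close> and
    \<open>before\<close>; an edge that only passes through contributes \<open>g - g\<close> on the
    right-hand side.\<close>
  have edge: "(if px e = s \<and> py e = h then sgn (fx e) * g else 0) - (if qx e = s \<and> qy e = h then sgn (fx e) * g else 0) =
     (if e \<in> after s \<and> ht e s = h then g else 0) - (if e \<in> before s \<and> ht e s = h then g else 0)"
    if e: "e \<in> K" and g: "fx e = 0 \<Longrightarrow> g = 0" for e h and g :: real
  proof (cases "fx e" "0::real" rule: linorder_cases)
    case greater
    then show ?thesis using e fx_pos[of e] ht_px[of e] ht_qx[of e]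
      by (auto simp: after_def before_def left_def right_def)
  next
    case less
    then show ?thesis using e fx_neg[of e] ht_px[of e] ht_qx[of e]
      by (auto simp: after_def before_def left_def right_def)
  qed (use g in simp)
  have fibre: "(\<Sum>e\<in>{e\<in>S. ht e s = h}. g e) = (\<Sum>e\<in>K. if e \<in> S \<and> ht e s = h then g e else 0)"
    if "S \<subseteq> K" for S h and g :: "'e \<Rightarrow> real"
    using that finite_K by (intro sum.mono_neutral_cong_left) auto
  have key: "(\<Sum>e\<in>{e\<in>before s. ht e s = h}. g e) = (\<Sum>e\<in>{e\<in>after s. ht e s = h}. g e)"
    if "(\<Sum>e\<in>K. (if px e = s \<and> py e = h then f e else 0) - (if qx e = s \<and> qy e = h then f e else 0)) = 0"
      and "\<And>e. e \<in> K \<Longrightarrow> f e = sgn (fx e) * g e" "\<And>e. e \<in> K \<Longrightarrow> fx e = 0 \<Longrightarrow> g e = 0"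
    for h and f g :: "'e \<Rightarrow> real"
  proof -
    have "(\<Sum>e\<in>K. (if e \<in> after s \<and> ht e s = h then g e else 0) - (if e \<in> before s \<and> ht e s = h then g e else 0))
      = (\<Sum>e\<in>K. (if px e = s \<and> py e = h then f e else 0) - (if qx e = s \<and> qy e = h then f e else 0))"
      using that(2,3) by (intro sum.cong refl) (simp only: edge[symmetric] that(2))
    then show ?thesis
      unfolding fibre[OF before_sub] fibre[OF after_sub] using that(1) by (simp add: sum_subtractf)
  qed
  show ?thesis
    unfolding balanced_def
  proof (intro allI conjI)
    fix h
    show "(\<Sum>e\<in>{e\<in>before s. ht e s = h}. \<bar>fx e\<bar>) = (\<Sum>e\<in>{e\<in>after s. ht e s = h}. \<bar>fx e\<bar>)"
      by (rule key[OF assms(1)]) (auto simp: sgn_if)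
    show "(\<Sum>e\<in>{e\<in>before s. ht e s = h}. \<bar>fx e\<bar> * slope e) = (\<Sum>e\<in>{e\<in>after s. ht e s = h}. \<bar>fx e\<bar> * slope e)"
      by (rule key[OF assms(2)]) (auto simp: sgn_if slope_def nonvertical)
  qed
qed

text \<open>
  Two of three segments that meet at a common end lie on the same side of its vertical line.
\<close>

lemma gain_of_three:
  assumes K: "e1 \<in> K" "e2 \<in> K" "e3 \<in> K"
    and ends: "qx e1 = s" "qy e1 = h" "px e2 = s" "py e2 = h" "px e3 = s" "py e3 = h"
    and x: "2 * fx e3 = fx e1 - fx e2" and y: "2 * fy e3 = fy e1 - fy e2"
  shows "\<bar>fx e1 * fy e2 - fy e1 * fx e2\<bar> / 2 \<le> gain s e1 e2 + gain s e1 e3 + gain s e2 e3"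
proof (cases "fx e1 = 0 \<or> fx e2 = 0 \<or> fx e3 = 0")
  case True
  \<comment> \<open>Either \<open>e1\<close> or \<open>e2\<close> carries no force, or
    \<open>e3\<close> carries none and the forces of \<open>e1\<close> and \<open>e2\<close>
    agree.\<close>
  then have "fx e1 * fy e2 - fy e1 * fx e2 = 0"
    using K nonvertical x y by (smt (verit) mult_eq_0_iff mult.commute)
  then show ?thesis by (simp add: gain_nonneg add_nonneg_nonneg)
next
  case False
  define D where "D = \<bar>fx e1 * fy e2 - fy e1 * fx e2\<bar> / 2"
  have f3: "fx e3 = (fx e1 - fx e2) / 2" "fy e3 = (fy e1 - fy e2) / 2" using x y by auto
  \<comment> \<open>The force of \<open>e3\<close> is half the difference of the other two, so its
    wedge product with either of them is half of theirs up to sign.\<close>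
  have pairs: "pair e1 e2 \<ge> D" "pair e1 e3 \<ge> D" "pair e2 e3 \<ge> D"
  proof -
    have "fx e1 * fy e3 - fy e1 * fx e3 = - ((fx e1 * fy e2 - fy e1 * fx e2) / 2)"
      "fx e2 * fy e3 - fy e2 * fx e3 = - ((fx e1 * fy e2 - fy e1 * fx e2) / 2)"
      unfolding f3 by (simp_all add: field_simps)
    then show "pair e1 e2 \<ge> D" "pair e1 e3 \<ge> D" "pair e2 e3 \<ge> D"
      unfolding pair_eq[OF K(1,2)] pair_eq[OF K(1,3)] pair_eq[OF K(2,3)] D_def by simp_all
  qed
  have side: "e \<in> K \<Longrightarrow> fx e \<noteq> 0 \<Longrightarrow> px e = s \<or> qx e = s \<Longrightarrow> e \<in> before s \<or> e \<in> after s" for e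
    using fx_pos[of e] fx_neg[of e] by (cases "fx e > 0") (auto simp: before_def after_def left_def right_def)
  have hts: "ht e1 s = h" "ht e2 s = h" "ht e3 s = h"
    using ends K False ht_qx[of e1] ht_px[of e2] ht_px[of e3] by auto
  have "(e1 \<in> before s \<and> e2 \<in> before s) \<or> (e1 \<in> after s \<and> e2 \<in> after s) \<or>
    (e1 \<in> before s \<and> e3 \<in> before s) \<or> (e1 \<in> after s \<and> e3 \<in> after s) \<or>
    (e2 \<in> before s \<and> e3 \<in> before s) \<or> (e2 \<in> after s \<and> e3 \<in> after s)"
    using side K ends False by blast
  moreover have "gain s e e' \<ge> D" if "(e \<in> before s \<and> e' \<in> before s) \<or> (e \<in> after s \<and> e' \<in> after s)"
    "ht e s = h" "ht e' s = h" "pair e e' \<ge> D" for e e'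
    using that meet_nonneg[OF before_sub, of s s e e'] meet_nonneg[OF after_sub, of s s e e']
    by (auto simp: gain_def meet_def split: if_splits)
  ultimately show ?thesis
    unfolding D_def[symmetric] using hts pairs gain_nonneg[of s e1 e2] gain_nonneg[of s e1 e3] gain_nonneg[of s e2 e3]
    by (smt (verit))
qed

end

section \<open>The planar framework of a system of colliding particles\<close>

text \<open>
  Edge \<open>(True, \<alpha>, k)\<close> is the trajectory of \<open>\<alpha>\<close> between its positions \<open>Z \<alpha> k\<close> and \<open>Z \<alpha> (Suc k)\<close>.
  Edge \<open>(False, \<alpha>, k)\<close> joins \<open>\<alpha>\<close> to its partner \<open>p k \<alpha>\<close> in the \<open>k\<close>-th collision. It carries only half
  of the exchanged momentum since the edge \<open>(False, p k \<alpha>, k)\<close> joins the same points.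
\<close>

definition edges :: "'a set \<Rightarrow> nat \<Rightarrow> (bool \<times> 'a \<times> nat) set" where
  "edges A m = {True} \<times> A \<times> {0..m} \<union> {False} \<times> A \<times> {1..m}"

definition tail :: "('a \<Rightarrow> nat \<Rightarrow> real) \<Rightarrow> bool \<times> 'a \<times> nat \<Rightarrow> real" where
  "tail Z = (\<lambda>(b, \<alpha>, k). Z \<alpha> k)"

definition head :: "(nat \<Rightarrow> 'a \<Rightarrow> 'a) \<Rightarrow> ('a \<Rightarrow> nat \<Rightarrow> real) \<Rightarrow> bool \<times> 'a \<times> nat \<Rightarrow> real" where
  "head p Z = (\<lambda>(b, \<alpha>, k). if b then Z \<alpha> (Suc k) else Z (p k \<alpha>) k)"

definition force :: "('a \<Rightarrow> nat \<Rightarrow> real) \<Rightarrow> bool \<times> 'a \<times> nat \<Rightarrow> real" where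
  "force W = (\<lambda>(b, \<alpha>, k). if b then W \<alpha> k else (W \<alpha> (k - 1) - W \<alpha> k) / 2)"

lemma tail_apply [simp]: "tail Z (b, \<alpha>, k) = Z \<alpha> k"
  and head_apply [simp]: "head p Z (b, \<alpha>, k) = (if b then Z \<alpha> (Suc k) else Z (p k \<alpha>) k)"
  and force_apply [simp]: "force W (b, \<alpha>, k) = (if b then W \<alpha> k else (W \<alpha> (k - 1) - W \<alpha> k) / 2)"
  by (auto simp: tail_def head_def force_def)

lemma finite_edges: "finite A \<Longrightarrow> finite (edges A m)"
  by (simp add: edges_def)

lemma sum_edges:
  fixes f :: "bool \<times> 'a \<times> nat \<Rightarrow> real"
  assumes "finite A"
  shows "(\<Sum>e\<in>edges A m. f e) =
    (\<Sum>\<alpha>\<in>A. \<Sum>k\<in>{0..m}. f (True, \<alpha>, k)) + (\<Sum>\<alpha>\<in>A. \<Sum>k\<in>{1..m}. f (False, \<alpha>, k))"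
proof -
  have "(\<Sum>e\<in>{b} \<times> A \<times> S. f e) = (\<Sum>\<alpha>\<in>A. \<Sum>k\<in>S. f (b, \<alpha>, k))" for b :: bool and S :: "nat set"
    unfolding sum.cartesian_product by (rule sum.reindex_bij_witness[of _ "\<lambda>x. (b, x)" snd]) auto
  then show ?thesis
    unfolding edges_def using assms by (subst sum.union_disjoint) auto
qed

lemma sum_involution:
  assumes "\<And>x. x \<in> A \<Longrightarrow> p x \<in> A \<and> p (p x) = x"
  shows "(\<Sum>x\<in>A. f (p x)) = (\<Sum>x\<in>A. f x)"
  by (rule sum.reindex_bij_witness[of _ p p]) (use assms in auto)

text \<open>The predicate \<open>at_z\<close> selects the nodes at one point of the plane; several
  nodes may coincide there. At each node the flights leave a defect
  \<open>W \<alpha> (k - 1) - W \<alpha> k\<close>, half of which is supplied by the contact edge of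
  the particle and half by that of its partner, whose head is at the node.\<close>

lemma framework_balance:
  fixes W :: "'a \<Rightarrow> nat \<Rightarrow> real" and at_z :: "'a \<Rightarrow> nat \<Rightarrow> bool"
  assumes A: "finite A"
    and p: "\<And>\<alpha> k. \<alpha> \<in> A \<Longrightarrow> k \<in> {1..m} \<Longrightarrow> p k \<alpha> \<in> A \<and> p k (p k \<alpha>) = \<alpha>"
    and momentum: "\<And>\<alpha> k. \<alpha> \<in> A \<Longrightarrow> k \<in> {1..m} \<Longrightarrow>
      W (p k \<alpha>) (k - 1) - W (p k \<alpha>) k = - (W \<alpha> (k - 1) - W \<alpha> k)"
    and outer: "\<And>\<alpha>. \<alpha> \<in> A \<Longrightarrow> at_z \<alpha> 0 \<Longrightarrow> W \<alpha> 0 = 0" "\<And>\<alpha>. \<alpha> \<in> A \<Longrightarrow> at_z \<alpha> (Suc m) \<Longrightarrow> W \<alpha> m = 0"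
    and t: "\<And>b \<alpha> k. t (b, \<alpha>, k) \<longleftrightarrow> at_z \<alpha> k"
    and h: "\<And>b \<alpha> k. h (b, \<alpha>, k) \<longleftrightarrow> (if b then at_z \<alpha> (Suc k) else at_z (p k \<alpha>) k)"
  shows "(\<Sum>e\<in>edges A m. (if t e then force W e else 0) - (if h e then force W e else 0)) = 0"
proof -
  define D where "D \<alpha> k = W \<alpha> (k - 1) - W \<alpha> k" for \<alpha> k
  define U where "U = (\<Sum>\<alpha>\<in>A. \<Sum>k\<in>{1..m}. if at_z \<alpha> k then D \<alpha> k else 0)"
  have "(\<Sum>\<alpha>\<in>A. \<Sum>k\<in>{0..m}. (if at_z \<alpha> k then W \<alpha> k else 0) - (if at_z \<alpha> (Suc k) then W \<alpha> k else 0)) = - U"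
    unfolding U_def sum_negf[symmetric]
  proof (rule sum.cong[OF refl])
    fix \<alpha> assume \<alpha>: "\<alpha> \<in> A"
    have "(\<Sum>k\<in>{0..m}. if at_z \<alpha> k then W \<alpha> k else 0) = (\<Sum>k\<in>{1..m}. if at_z \<alpha> k then W \<alpha> k else 0)"
      using outer(1)[OF \<alpha>] by (subst sum.atLeast_Suc_atMost) auto
    moreover have "(\<Sum>k\<in>{0..m}. if at_z \<alpha> (Suc k) then W \<alpha> k else 0) =
        (\<Sum>k\<in>{1..m}. if at_z \<alpha> k then W \<alpha> (k - 1) else 0)"
    proof -
      have "(\<Sum>k\<in>{0..m}. if at_z \<alpha> (Suc k) then W \<alpha> k else 0) =
          (\<Sum>k\<in>{Suc 0..Suc m}. if at_z \<alpha> k then W \<alpha> (k - 1) else 0)"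
        by (subst sum.shift_bounds_cl_Suc_ivl) (simp cong: if_cong)
      then show ?thesis using outer(2)[OF \<alpha>] by simp
    qed
    ultimately show "(\<Sum>k\<in>{0..m}. (if at_z \<alpha> k then W \<alpha> k else 0) - (if at_z \<alpha> (Suc k) then W \<alpha> k else 0)) =
        (\<Sum>k\<in>{1..m}. - (if at_z \<alpha> k then D \<alpha> k else 0))"
      unfolding sum_subtractf by (simp add: sum_subtractf[symmetric] D_def cong: if_cong)
        (auto intro!: sum.cong)
  qed
  \<comment> \<open>Reindexing by the involution \<open>p k\<close> moves the heads to the tails,
    and conservation of momentum reverses the sign, so the two halves add up.\<close>
  moreover have "(\<Sum>\<alpha>\<in>A. \<Sum>k\<in>{1..m}. (if at_z \<alpha> k then D \<alpha> k / 2 else 0) - (if at_z (p k \<alpha>) k then D \<alpha> k / 2 else 0)) = U"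
    unfolding U_def
  proof (subst (1 2) sum.swap, rule sum.cong[OF refl])
    fix k assume k: "k \<in> {1..m}"
    have "(\<Sum>\<alpha>\<in>A. if at_z (p k \<alpha>) k then D \<alpha> k / 2 else 0) =
        (\<Sum>\<alpha>\<in>A. if at_z (p k \<alpha>) k then - D (p k \<alpha>) k / 2 else 0)"
      using momentum k by (intro sum.cong refl) (auto simp: D_def)
    also have "\<dots> = (\<Sum>\<alpha>\<in>A. if at_z \<alpha> k then - D \<alpha> k / 2 else 0)"
      using p k by (intro sum_involution) auto
    finally show "(\<Sum>\<alpha>\<in>A. (if at_z \<alpha> k then D \<alpha> k / 2 else 0) - (if at_z (p k \<alpha>) k then D \<alpha> k / 2 else 0)) =
        (\<Sum>\<alpha>\<in>A. if at_z \<alpha> k then D \<alpha> k else 0)"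
      unfolding sum_subtractf by (simp only:) (auto simp: sum_subtractf[symmetric] intro!: sum.cong)
  qed
  ultimately show ?thesis
    unfolding sum_edges[OF A] by (simp add: t h D_def cong: if_cong)
qed

text \<open>The sweep runs over a band that contains all collisions, so only first and last flights
  cross its borders. The constant is 2 * 3 * 4: \<open>gain_of_three\<close> controls half of each
  wedge product, each of its three terms sums to at most the total gain, and each of the two borders
  contributes at most twice the product of the force sums.\<close>

lemma planar_estimate_nonvertical:
  fixes Zx Zy Wx Wy lam kap :: "'a \<Rightarrow> nat \<Rightarrow> real"
  assumes A: "finite A" and m: "m \<ge> 1" and R: "R > 0"
    and inner: "\<And>\<alpha> k. \<alpha> \<in> A \<Longrightarrow> k \<in> {1..m} \<Longrightarrow> \<bar>Zx \<alpha> k\<bar> < R"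
    and outer: "\<And>\<alpha>. \<alpha> \<in> A \<Longrightarrow> Wx \<alpha> 0 = 0 \<or> \<bar>Zx \<alpha> 0\<bar> \<ge> R"
      "\<And>\<alpha>. \<alpha> \<in> A \<Longrightarrow> Wx \<alpha> m = 0 \<or> \<bar>Zx \<alpha> (Suc m)\<bar> \<ge> R"
    and lam: "\<And>\<alpha> k. \<alpha> \<in> A \<Longrightarrow> k \<le> m \<Longrightarrow> lam \<alpha> k \<ge> 0"
    and Wx: "\<And>\<alpha> k. \<alpha> \<in> A \<Longrightarrow> k \<le> m \<Longrightarrow> Wx \<alpha> k = lam \<alpha> k * (Zx \<alpha> (Suc k) - Zx \<alpha> k)"
    and Wy: "\<And>\<alpha> k. \<alpha> \<in> A \<Longrightarrow> k \<le> m \<Longrightarrow> Wy \<alpha> k = lam \<alpha> k * (Zy \<alpha> (Suc k) - Zy \<alpha> k)"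
    and p: "\<And>\<alpha> k. \<alpha> \<in> A \<Longrightarrow> k \<in> {1..m} \<Longrightarrow> p k \<alpha> \<in> A \<and> p k (p k \<alpha>) = \<alpha>"
    and kap: "\<And>\<alpha> k. \<alpha> \<in> A \<Longrightarrow> k \<in> {1..m} \<Longrightarrow> kap \<alpha> k \<ge> 0"
    and Cx: "\<And>\<alpha> k. \<alpha> \<in> A \<Longrightarrow> k \<in> {1..m} \<Longrightarrow> Wx \<alpha> (k - 1) - Wx \<alpha> k = kap \<alpha> k * (Zx (p k \<alpha>) k - Zx \<alpha> k)"
    and Cy: "\<And>\<alpha> k. \<alpha> \<in> A \<Longrightarrow> k \<in> {1..m} \<Longrightarrow> Wy \<alpha> (k - 1) - Wy \<alpha> k = kap \<alpha> k * (Zy (p k \<alpha>) k - Zy \<alpha> k)"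
    and momx: "\<And>\<alpha> k. \<alpha> \<in> A \<Longrightarrow> k \<in> {1..m} \<Longrightarrow>
      Wx (p k \<alpha>) (k - 1) - Wx (p k \<alpha>) k = - (Wx \<alpha> (k - 1) - Wx \<alpha> k)"
    and momy: "\<And>\<alpha> k. \<alpha> \<in> A \<Longrightarrow> k \<in> {1..m} \<Longrightarrow>
      Wy (p k \<alpha>) (k - 1) - Wy (p k \<alpha>) k = - (Wy \<alpha> (k - 1) - Wy \<alpha> k)"
    and nonv: "\<And>\<alpha> k. \<alpha> \<in> A \<Longrightarrow> k \<le> m \<Longrightarrow> Wx \<alpha> k = 0 \<Longrightarrow> Wy \<alpha> k = 0"
      "\<And>\<alpha> k. \<alpha> \<in> A \<Longrightarrow> k \<in> {1..m} \<Longrightarrow> Wx \<alpha> (k - 1) = Wx \<alpha> k \<Longrightarrow> Wy \<alpha> (k - 1) = Wy \<alpha> k"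
  shows "(\<Sum>\<alpha>\<in>A. \<Sum>k\<in>{1..m}. \<bar>Wx \<alpha> (k - 1) * Wy \<alpha> k - Wy \<alpha> (k - 1) * Wx \<alpha> k\<bar>) \<le>
    24 * (\<Sum>\<alpha>\<in>A. \<bar>Wx \<alpha> 0\<bar> + \<bar>Wx \<alpha> m\<bar>) * (\<Sum>\<alpha>\<in>A. \<bar>Wy \<alpha> 0\<bar> + \<bar>Wy \<alpha> m\<bar>)"
proof -
  let ?K = "edges A m"
  interpret segments ?K "tail Zx" "tail Zy" "head p Zx" "head p Zy" "force Wx" "force Wy"
    "\<lambda>(b, \<alpha>, k). if b then lam \<alpha> k else kap \<alpha> k / 2"
  proof
    show "finite (edges A m)" using A by (rule finite_edges)
    fix e assume e: "e \<in> ?K"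
    show "(case e of (b, \<alpha>, k) \<Rightarrow> if b then lam \<alpha> k else kap \<alpha> k / 2) \<ge> 0"
      using e lam kap by (auto simp: edges_def)
    show "force Wx e = (case e of (b, \<alpha>, k) \<Rightarrow> if b then lam \<alpha> k else kap \<alpha> k / 2) * (head p Zx e - tail Zx e)"
      using e Wx Cx by (auto simp: edges_def)
    show "force Wy e = (case e of (b, \<alpha>, k) \<Rightarrow> if b then lam \<alpha> k else kap \<alpha> k / 2) * (head p Zy e - tail Zy e)"
      using e Wy Cy by (auto simp: edges_def)
    show "force Wx e = 0 \<Longrightarrow> force Wy e = 0"
      using e nonv by (auto simp: edges_def)
  qed
  \<comment> \<open>The indices 0 and \<open>Suc m\<close> are included because a first or last edge
    with \<open>Wx\<close> equal to 0 may end inside the band.\<close>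
  define C where "C = {Zx \<alpha> k | \<alpha> k. \<alpha> \<in> A \<and> k \<le> Suc m} \<inter> {-R<..<R}"
  have C: "finite C"
  proof -
    have "{Zx \<alpha> k | \<alpha> k. \<alpha> \<in> A \<and> k \<le> Suc m} = (\<lambda>(\<alpha>, k). Zx \<alpha> k) ` (A \<times> {..Suc m})"
      by auto
    then show ?thesis unfolding C_def using A by simp
  qed
  have bal: "balanced s" if s: "-R < s" "s < R" for s
  proof (rule balancedI)
    have o: "\<And>\<alpha>. \<alpha> \<in> A \<Longrightarrow> Zx \<alpha> 0 = s \<Longrightarrow> Wx \<alpha> 0 = 0 \<and> Wy \<alpha> 0 = 0"
      "\<And>\<alpha>. \<alpha> \<in> A \<Longrightarrow> Zx \<alpha> (Suc m) = s \<Longrightarrow> Wx \<alpha> m = 0 \<and> Wy \<alpha> m = 0"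
      using outer s nonv(1) by (metis abs_less_iff leD le0 minus_less_iff order_refl)+
    fix h
    show "(\<Sum>e\<in>?K. (if tail Zx e = s \<and> tail Zy e = h then force Wx e else 0) -
        (if head p Zx e = s \<and> head p Zy e = h then force Wx e else 0)) = 0"
      by (rule framework_balance[where at_z = "\<lambda>\<alpha> k. Zx \<alpha> k = s \<and> Zy \<alpha> k = h" and p = p
            and t = "\<lambda>e. tail Zx e = s \<and> tail Zy e = h" and h = "\<lambda>e. head p Zx e = s \<and> head p Zy e = h"])
        (use A p momx o in \<open>simp_all\<close>)
    show "(\<Sum>e\<in>?K. (if tail Zx e = s \<and> tail Zy e = h then force Wy e else 0) -
        (if head p Zx e = s \<and> head p Zy e = h then force Wy e else 0)) = 0"
      by (rule framework_balance[where at_z = "\<lambda>\<alpha> k. Zx \<alpha> k = s \<and> Zy \<alpha> k = h" and p = p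
            and t = "\<lambda>e. tail Zx e = s \<and> tail Zy e = h" and h = "\<lambda>e. head p Zx e = s \<and> head p Zy e = h"])
        (use A p momy o in \<open>simp_all\<close>)
  qed
  define G where "G = (\<Sum>s\<in>C. \<Sum>e\<in>?K. \<Sum>e'\<in>?K. gain s e e')"
  define rays where "rays = {True} \<times> A \<times> {0, m}"
  have rays_sum: "(\<Sum>e\<in>rays. \<bar>force W e\<bar>) = (\<Sum>\<alpha>\<in>A. \<bar>W \<alpha> 0\<bar> + \<bar>W \<alpha> m\<bar>)" for W
  proof -
    have "(\<Sum>e\<in>rays. \<bar>force W e\<bar>) = (\<Sum>(\<alpha>, k)\<in>A \<times> {0, m}. \<bar>W \<alpha> k\<bar>)"
      unfolding rays_def
      by (rule sum.reindex_bij_witness[of _ "\<lambda>x. (True, x)" snd]) (auto)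
    then show ?thesis using m by (simp add: sum.cartesian_product[symmetric])
  qed
  have pairs: "(\<Sum>e\<in>S. \<Sum>e'\<in>S. pair e e') \<le>
      2 * (\<Sum>\<alpha>\<in>A. \<bar>Wx \<alpha> 0\<bar> + \<bar>Wx \<alpha> m\<bar>) * (\<Sum>\<alpha>\<in>A. \<bar>Wy \<alpha> 0\<bar> + \<bar>Wy \<alpha> m\<bar>)" if S: "S \<subseteq> rays" for S
  proof -
    have fr: "finite rays" and rK: "rays \<subseteq> ?K" using A by (auto simp: rays_def edges_def)
    have "(\<Sum>e\<in>S. \<Sum>e'\<in>S. pair e e') \<le> (\<Sum>e\<in>rays. \<Sum>e'\<in>rays. pair e e')"
      unfolding sum.cartesian_product using S fr rK
      by (intro sum_mono2) (auto intro!: pair_nonneg)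
    also have "\<dots> \<le> (\<Sum>e\<in>rays. \<Sum>e'\<in>rays. \<bar>force Wx e\<bar> * \<bar>force Wy e'\<bar> + \<bar>force Wy e\<bar> * \<bar>force Wx e'\<bar>)"
    proof (intro sum_mono)
      fix e e' assume "e \<in> rays" "e' \<in> rays"
      then have "pair e e' = \<bar>force Wx e * force Wy e' - force Wy e * force Wx e'\<bar>"
        using rK by (intro pair_eq) auto
      then show "pair e e' \<le> \<bar>force Wx e\<bar> * \<bar>force Wy e'\<bar> + \<bar>force Wy e\<bar> * \<bar>force Wx e'\<bar>"
        using abs_triangle_ineq4[of "force Wx e * force Wy e'" "force Wy e * force Wx e'"]
        by (simp only: abs_mult)
    qed
    also have "\<dots> = 2 * (\<Sum>e\<in>rays. \<bar>force Wx e\<bar>) * (\<Sum>e\<in>rays. \<bar>force Wy e\<bar>)"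
      by (simp add: sum.distrib sum_product[symmetric])
    finally show ?thesis unfolding rays_sum .
  qed
  \<comment> \<open>An edge that crosses a border has an end outside the open band, while contact
    edges and the flights between two collisions have both ends inside.\<close>
  have "after (-R) \<subseteq> rays" "before R \<subseteq> rays"
  proof -
    have "e \<in> rays" if e: "e \<in> ?K" and far: "\<bar>tail Zx e\<bar> \<ge> R \<or> \<bar>head p Zx e\<bar> \<ge> R" for e
    proof -
      obtain b \<alpha> k where [simp]: "e = (b, \<alpha>, k)" by (cases e)
      show ?thesis
      proof (cases b)
        case True
        then have "\<alpha> \<in> A" "k \<le> m" using e by (auto simp: edges_def)
        moreover have "k = 0 \<or> k = m"
        proof (rule ccontr)
          assume "\<not> (k = 0 \<or> k = m)"
          then show False
            using far True inner[of \<alpha> k] inner[of \<alpha> "Suc k"] calculation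
            by auto
        qed
        ultimately show ?thesis using True by (auto simp: rays_def)
      next
        case False
        then show ?thesis
          using e far inner[of \<alpha> k] inner[of "p k \<alpha>" k] p[of \<alpha> k]
          by (auto simp: edges_def)
      qed
    qed
    moreover have "\<bar>tail Zx e\<bar> \<ge> R \<or> \<bar>head p Zx e\<bar> \<ge> R" if "e \<in> after (-R) \<or> e \<in> before R" for e
      using that R by (auto simp: after_def before_def left_def right_def)
    ultimately show "after (-R) \<subseteq> rays" "before R \<subseteq> rays"
      using after_sub before_sub by blast+
  qed
  then have "G \<le> 4 * (\<Sum>\<alpha>\<in>A. \<bar>Wx \<alpha> 0\<bar> + \<bar>Wx \<alpha> m\<bar>) * (\<Sum>\<alpha>\<in>A. \<bar>Wy \<alpha> 0\<bar> + \<bar>Wy \<alpha> m\<bar>)"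
  proof -
    have "G \<le> (\<Sum>e\<in>after (-R). \<Sum>e'\<in>after (-R). pair e e') + (\<Sum>e\<in>before R. \<Sum>e'\<in>before R. pair e e')"
      unfolding G_def
    proof (rule total_gain[OF C])
      show "- R < R" using R by simp
      show "- R < s \<and> s < R \<and> balanced s" if "s \<in> C" for s using that bal by (auto simp: C_def)
      fix e assume e: "e \<in> ?K"
      obtain b \<alpha> k where e_eq: "e = (b, \<alpha>, k)" by (cases e)
      have "\<alpha> \<in> A" "k \<le> m" "\<not> b \<Longrightarrow> p k \<alpha> \<in> A" using e p[of \<alpha> k] by (auto simp: e_eq edges_def)
      moreover have node: "Zx \<beta> j \<in> {Zx \<alpha> k | \<alpha> k. \<alpha> \<in> A \<and> k \<le> Suc m}" if "\<beta> \<in> A" "j \<le> Suc m" for \<beta> j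
        using that by blast
      ultimately have "tail Zx e \<in> {Zx \<alpha> k | \<alpha> k. \<alpha> \<in> A \<and> k \<le> Suc m}"
        "head p Zx e \<in> {Zx \<alpha> k | \<alpha> k. \<alpha> \<in> A \<and> k \<le> Suc m}"
        using node[of \<alpha> k] node[of \<alpha> "Suc k"] node[of "p k \<alpha>" k]
        by (simp_all only: e_eq tail_apply head_apply split: if_splits) auto
      then show "left e \<notin> {-R<..<R} - C \<and> right e \<notin> {-R<..<R} - C"
        unfolding left_def right_def C_def min_def max_def
        by (cases "tail Zx e \<le> head p Zx e") (simp_all only: if_True if_False, blast+)
    qed
    also note add_mono[OF pairs[OF \<open>after (-R) \<subseteq> rays\<close>] pairs[OF \<open>before R \<subseteq> rays\<close>]]
    finally show ?thesis by simp
  qed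
  moreover have "(\<Sum>(\<alpha>, k)\<in>A \<times> {1..m}. \<bar>Wx \<alpha> (k - 1) * Wy \<alpha> k - Wy \<alpha> (k - 1) * Wx \<alpha> k\<bar> / 2) \<le> G + G + G"
  proof -
    let ?e1 = "\<lambda>(\<alpha>, k). (True, \<alpha>, k - 1)" and ?e2 = "\<lambda>(\<alpha>, k). (True, \<alpha>, k)" and ?e3 = "\<lambda>(\<alpha>, k). (False, \<alpha>, k)"
    let ?s = "\<lambda>(\<alpha>, k). Zx \<alpha> k"
    have sC: "?s i \<in> C" if "i \<in> A \<times> {1..m}" for i
      using that inner[of "fst i" "snd i"] by (force simp: C_def)
    have "(\<Sum>(\<alpha>, k)\<in>A \<times> {1..m}. \<bar>Wx \<alpha> (k - 1) * Wy \<alpha> k - Wy \<alpha> (k - 1) * Wx \<alpha> k\<bar> / 2) \<le>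
      (\<Sum>i\<in>A \<times> {1..m}. gain (?s i) (?e1 i) (?e2 i) + gain (?s i) (?e1 i) (?e3 i) + gain (?s i) (?e2 i) (?e3 i))"
    proof (intro sum_mono)
      fix i assume i: "i \<in> A \<times> {1..m}"
      obtain \<alpha> k where [simp]: "i = (\<alpha>, k)" by (cases i)
      have mem: "(True, \<alpha>, k - 1) \<in> ?K" "(True, \<alpha>, k) \<in> ?K" "(False, \<alpha>, k) \<in> ?K" and k: "k \<ge> 1"
        using i by (auto simp: edges_def)
      show "(case i of (\<alpha>, k) \<Rightarrow> \<bar>Wx \<alpha> (k - 1) * Wy \<alpha> k - Wy \<alpha> (k - 1) * Wx \<alpha> k\<bar> / 2) \<le>
        gain (?s i) (?e1 i) (?e2 i) + gain (?s i) (?e1 i) (?e3 i) + gain (?s i) (?e2 i) (?e3 i)"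
        using gain_of_three[OF mem, of "Zx \<alpha> k" "Zy \<alpha> k"] k
        by simp
    qed
    \<comment> \<open>For each of the three choices of two edges, the map from nodes to pairs is
      injective, so \<open>sum_gain_le\<close> bounds its gains by \<open>G\<close>.\<close>
    also have "\<dots> \<le> G + G + G"
      unfolding sum.distrib G_def using sC
      by (intro add_mono sum_gain_le[OF C]) (auto simp: inj_on_def edges_def)
    finally show ?thesis .
  qed
  ultimately have "(\<Sum>(\<alpha>, k)\<in>A \<times> {1..m}. \<bar>Wx \<alpha> (k - 1) * Wy \<alpha> k - Wy \<alpha> (k - 1) * Wx \<alpha> k\<bar>) \<le>
     24 * (\<Sum>\<alpha>\<in>A. \<bar>Wx \<alpha> 0\<bar> + \<bar>Wx \<alpha> m\<bar>) * (\<Sum>\<alpha>\<in>A. \<bar>Wy \<alpha> 0\<bar> + \<bar>Wy \<alpha> m\<bar>)"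
    by (simp add: case_prod_unfold sum_divide_distrib[symmetric])
  then show ?thesis by (simp add: sum.cartesian_product)
qed

text \<open>
  A shear makes the framework free of vertical edges and preserves the wedge products. The
  first and last edges are prolonged beyond the band that contains all collisions.
\<close>

lemma planar_estimate:
  fixes Zx Zy Wx Wy lam kap :: "'a \<Rightarrow> nat \<Rightarrow> real"
  assumes A: "finite A"
    and lam: "\<And>\<alpha> k. \<alpha> \<in> A \<Longrightarrow> k \<in> {1..<m} \<Longrightarrow> lam \<alpha> k \<ge> 0"
    and Wx: "\<And>\<alpha> k. \<alpha> \<in> A \<Longrightarrow> k \<in> {1..<m} \<Longrightarrow> Wx \<alpha> k = lam \<alpha> k * (Zx \<alpha> (Suc k) - Zx \<alpha> k)"
    and Wy: "\<And>\<alpha> k. \<alpha> \<in> A \<Longrightarrow> k \<in> {1..<m} \<Longrightarrow> Wy \<alpha> k = lam \<alpha> k * (Zy \<alpha> (Suc k) - Zy \<alpha> k)"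
    and p: "\<And>\<alpha> k. \<alpha> \<in> A \<Longrightarrow> k \<in> {1..m} \<Longrightarrow> p k \<alpha> \<in> A \<and> p k (p k \<alpha>) = \<alpha>"
    and kap: "\<And>\<alpha> k. \<alpha> \<in> A \<Longrightarrow> k \<in> {1..m} \<Longrightarrow> kap \<alpha> k \<ge> 0"
    and Cx: "\<And>\<alpha> k. \<alpha> \<in> A \<Longrightarrow> k \<in> {1..m} \<Longrightarrow> Wx \<alpha> (k - 1) - Wx \<alpha> k = kap \<alpha> k * (Zx (p k \<alpha>) k - Zx \<alpha> k)"
    and Cy: "\<And>\<alpha> k. \<alpha> \<in> A \<Longrightarrow> k \<in> {1..m} \<Longrightarrow> Wy \<alpha> (k - 1) - Wy \<alpha> k = kap \<alpha> k * (Zy (p k \<alpha>) k - Zy \<alpha> k)"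
    and momx: "\<And>\<alpha> k. \<alpha> \<in> A \<Longrightarrow> k \<in> {1..m} \<Longrightarrow>
      Wx (p k \<alpha>) (k - 1) - Wx (p k \<alpha>) k = - (Wx \<alpha> (k - 1) - Wx \<alpha> k)"
    and momy: "\<And>\<alpha> k. \<alpha> \<in> A \<Longrightarrow> k \<in> {1..m} \<Longrightarrow>
      Wy (p k \<alpha>) (k - 1) - Wy (p k \<alpha>) k = - (Wy \<alpha> (k - 1) - Wy \<alpha> k)"
  shows "(\<Sum>\<alpha>\<in>A. \<Sum>k\<in>{1..m}. \<bar>Wx \<alpha> (k - 1) * Wy \<alpha> k - Wy \<alpha> (k - 1) * Wx \<alpha> k\<bar>) \<le>
    24 * ((\<Sum>\<alpha>\<in>A. \<bar>Wx \<alpha> 0\<bar> + \<bar>Wx \<alpha> m\<bar>) + (\<Sum>\<alpha>\<in>A. \<bar>Wy \<alpha> 0\<bar> + \<bar>Wy \<alpha> m\<bar>)) *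
      (\<Sum>\<alpha>\<in>A. \<bar>Wy \<alpha> 0\<bar> + \<bar>Wy \<alpha> m\<bar>)"
proof (cases "m = 0")
  case True
  then show ?thesis by (simp add: sum_nonneg)
next
  case False
  then have m: "m \<ge> 1" by simp
  \<comment> \<open>These finitely many shear parameters include all those for which some flight or
    contact force becomes vertical without being zero.\<close>
  define bad where "bad = (\<lambda>(\<alpha>, k). - Wx \<alpha> k / Wy \<alpha> k) ` (A \<times> {..m}) \<union>
    (\<lambda>(\<alpha>, k). - (Wx \<alpha> (k - 1) - Wx \<alpha> k) / (Wy \<alpha> (k - 1) - Wy \<alpha> k)) ` (A \<times> {..m})"
  have bad1: "- Wx \<alpha> k / Wy \<alpha> k \<in> bad"
    and bad2: "- (Wx \<alpha> (k - 1) - Wx \<alpha> k) / (Wy \<alpha> (k - 1) - Wy \<alpha> k) \<in> bad"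
    if "\<alpha> \<in> A" "k \<le> m" for \<alpha> k
    unfolding bad_def using that
    by (auto intro!: image_eqI[where x = "(\<alpha>, k)"])
  have "infinite ({0<..<1::real} - bad)"
    unfolding bad_def using A by (intro Diff_infinite_finite) (auto simp: infinite_Ioo)
  then obtain \<kappa> where "\<kappa> \<in> {0<..<1::real} - bad" by (metis finite.emptyI all_not_in_conv)
  then have \<kappa>: "0 < \<kappa>" "\<kappa> < 1" "\<kappa> \<notin> bad" by auto
  define Vx where "Vx \<alpha> k = Wx \<alpha> k + \<kappa> * Wy \<alpha> k" for \<alpha> k
  define X where "X \<alpha> k = Zx \<alpha> k + \<kappa> * Zy \<alpha> k" for \<alpha> k
  have generic: "b = 0" if "a + \<kappa> * b = 0" "- a / b \<in> bad" for a b :: real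
  proof (rule ccontr)
    assume "b \<noteq> 0"
    then have "\<kappa> = - a / b" using that(1) by (simp add: field_simps)
    then show False using that \<kappa> by simp
  qed
  define R where "R = 1 + (\<Sum>\<alpha>\<in>A. \<Sum>k\<in>{1..m}. \<bar>X \<alpha> k\<bar>)"
  have R: "\<bar>X \<alpha> k\<bar> < R" if "\<alpha> \<in> A" "k \<in> {1..m}" for \<alpha> k
  proof -
    have "\<bar>X \<alpha> k\<bar> \<le> (\<Sum>k\<in>{1..m}. \<bar>X \<alpha> k\<bar>)" using that by (intro member_le_sum) auto
    also have "\<dots> \<le> (\<Sum>\<alpha>\<in>A. \<Sum>k\<in>{1..m}. \<bar>X \<alpha> k\<bar>)"
      using that A by (intro member_le_sum[of \<alpha> A "\<lambda>\<alpha>. \<Sum>k\<in>{1..m}. \<bar>X \<alpha> k\<bar>"]) (auto intro: sum_nonneg)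
    finally show ?thesis by (simp add: R_def)
  qed
  have "R > 0" by (auto simp: R_def intro!: add_pos_nonneg sum_nonneg)
  \<comment> \<open>Chosen so that the prolongation \<open>\<rho> * Vx \<alpha> k\<close> of each
    nonvanishing outer edge has length at least \<open>2 * R\<close>; starting within distance
    \<open>R\<close> of 0, it ends at distance at least \<open>R\<close>.\<close>
  define \<rho> where "\<rho> = 1 + (\<Sum>\<alpha>\<in>A. 2 * R / \<bar>Vx \<alpha> 0\<bar> + 2 * R / \<bar>Vx \<alpha> m\<bar>)"
  have "\<rho> > 0" using \<open>R > 0\<close> by (auto simp: \<rho>_def intro!: add_pos_nonneg sum_nonneg)
  have far: "\<bar>\<rho> * Vx \<alpha> k\<bar> \<ge> 2 * R" if "\<alpha> \<in> A" "k = 0 \<or> k = m" "Vx \<alpha> k \<noteq> 0" for \<alpha> k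
  proof -
    have "2 * R / \<bar>Vx \<alpha> k\<bar> \<le> 2 * R / \<bar>Vx \<alpha> 0\<bar> + 2 * R / \<bar>Vx \<alpha> m\<bar>"
      using that \<open>R > 0\<close> by auto
    also have "\<dots> \<le> (\<Sum>\<alpha>\<in>A. 2 * R / \<bar>Vx \<alpha> 0\<bar> + 2 * R / \<bar>Vx \<alpha> m\<bar>)"
      using that A \<open>R > 0\<close>
      by (intro member_le_sum[of \<alpha> A "\<lambda>\<alpha>. 2 * R / \<bar>Vx \<alpha> 0\<bar> + 2 * R / \<bar>Vx \<alpha> m\<bar>"]) auto
    finally have "2 * R / \<bar>Vx \<alpha> k\<bar> \<le> \<rho>" by (simp add: \<rho>_def)
    then show ?thesis using that \<open>\<rho> > 0\<close> by (simp add: field_simps abs_mult)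
  qed
  \<comment> \<open>The ends 0 and \<open>Suc m\<close> are new points on the first and last lines.
    The factor \<open>1 / \<rho>\<close> in \<open>lam'\<close> makes the force law hold on these
    edges too.\<close>
  define ext where "ext Z W \<alpha> k = (if k = 0 then Z \<alpha> 1 - \<rho> * W \<alpha> 0 else
    if k = Suc m then Z \<alpha> m + \<rho> * W \<alpha> m else Z \<alpha> k)" for Z W :: "'a \<Rightarrow> nat \<Rightarrow> real" and \<alpha> k
  define lam' where "lam' \<alpha> k = (if k = 0 \<or> k = m then 1 / \<rho> else lam \<alpha> k)" for \<alpha> k
  have ext_inner: "ext Z W \<alpha> k = Z \<alpha> k" if "k \<in> {1..m}" for Z W \<alpha> k
    using that by (auto simp: ext_def)
  have flight: "W \<alpha> k = lam' \<alpha> k * (ext Z W \<alpha> (Suc k) - ext Z W \<alpha> k)"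
    if "\<And>k. k \<in> {1..<m} \<Longrightarrow> W \<alpha> k = lam \<alpha> k * (Z \<alpha> (Suc k) - Z \<alpha> k)" "k \<le> m" for Z W \<alpha> k
    using that(1)[of k] that(2) m \<open>\<rho> > 0\<close> by (auto simp: lam'_def ext_def)
  have dV: "Vx \<alpha> j - Vx \<alpha> k = (Wx \<alpha> j - Wx \<alpha> k) + \<kappa> * (Wy \<alpha> j - Wy \<alpha> k)" for \<alpha> j k
    by (simp add: Vx_def algebra_simps)
  have est: "(\<Sum>\<alpha>\<in>A. \<Sum>k\<in>{1..m}. \<bar>Vx \<alpha> (k - 1) * Wy \<alpha> k - Wy \<alpha> (k - 1) * Vx \<alpha> k\<bar>) \<le>
    24 * (\<Sum>\<alpha>\<in>A. \<bar>Vx \<alpha> 0\<bar> + \<bar>Vx \<alpha> m\<bar>) * (\<Sum>\<alpha>\<in>A. \<bar>Wy \<alpha> 0\<bar> + \<bar>Wy \<alpha> m\<bar>)"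
  proof (rule planar_estimate_nonvertical[OF A m \<open>R > 0\<close>, where Zx = "ext X Vx" and Zy = "ext Zy Wy"
      and lam = lam' and kap = kap and p = p])
    fix \<alpha> assume \<alpha>: "\<alpha> \<in> A"
    show "Vx \<alpha> 0 = 0 \<or> \<bar>ext X Vx \<alpha> 0\<bar> \<ge> R"
      using far[OF \<alpha>, of 0] R[OF \<alpha>, of 1] m unfolding ext_def by simp linarith
    show "Vx \<alpha> m = 0 \<or> \<bar>ext X Vx \<alpha> (Suc m)\<bar> \<ge> R"
      using far[OF \<alpha>, of m] R[OF \<alpha>, of m] m unfolding ext_def by simp linarith
    fix k
    show "\<bar>ext X Vx \<alpha> k\<bar> < R" if "k \<in> {1..m}" using ext_inner R \<alpha> that by metis
    show "lam' \<alpha> k \<ge> 0" if "k \<le> m" using lam \<alpha> that \<open>\<rho> > 0\<close> by (auto simp: lam'_def)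
    show "Vx \<alpha> k = lam' \<alpha> k * (ext X Vx \<alpha> (Suc k) - ext X Vx \<alpha> k)" if "k \<le> m"
    proof (intro flight that)
      fix j assume j: "j \<in> {1..<m}"
      show "Vx \<alpha> j = lam \<alpha> j * (X \<alpha> (Suc j) - X \<alpha> j)"
        unfolding Vx_def X_def Wx[OF \<alpha> j] Wy[OF \<alpha> j] by (simp add: algebra_simps)
    qed
    show "Wy \<alpha> k = lam' \<alpha> k * (ext Zy Wy \<alpha> (Suc k) - ext Zy Wy \<alpha> k)" if "k \<le> m"
      using Wy \<alpha> that by (intro flight) auto
    show "Vx \<alpha> k = 0 \<Longrightarrow> Wy \<alpha> k = 0" if "k \<le> m"
      using bad1[OF \<alpha> that] by (rule generic[of "Wx \<alpha> k", rotated]) (simp add: Vx_def)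
    assume k: "k \<in> {1..m}"
    show "p k \<alpha> \<in> A \<and> p k (p k \<alpha>) = \<alpha>" "kap \<alpha> k \<ge> 0" using p kap \<alpha> k by auto
    show "Vx \<alpha> (k - 1) - Vx \<alpha> k = kap \<alpha> k * (ext X Vx (p k \<alpha>) k - ext X Vx \<alpha> k)"
      unfolding ext_inner[OF k] dV Cx[OF \<alpha> k] Cy[OF \<alpha> k] X_def by (simp add: algebra_simps)
    show "Wy \<alpha> (k - 1) - Wy \<alpha> k = kap \<alpha> k * (ext Zy Wy (p k \<alpha>) k - ext Zy Wy \<alpha> k)"
      using Cy[OF \<alpha> k] by (simp add: ext_inner[OF k])
    show "Vx (p k \<alpha>) (k - 1) - Vx (p k \<alpha>) k = - (Vx \<alpha> (k - 1) - Vx \<alpha> k)"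
      unfolding dV momx[OF \<alpha> k] momy[OF \<alpha> k] by (simp add: algebra_simps)
    show "Wy (p k \<alpha>) (k - 1) - Wy (p k \<alpha>) k = - (Wy \<alpha> (k - 1) - Wy \<alpha> k)"
      by (rule momy[OF \<alpha> k])
    show "Wy \<alpha> (k - 1) = Wy \<alpha> k" if "Vx \<alpha> (k - 1) = Vx \<alpha> k"
    proof -
      have "Wy \<alpha> (k - 1) - Wy \<alpha> k = 0"
      proof (rule generic[of "Wx \<alpha> (k - 1) - Wx \<alpha> k"])
        show "- (Wx \<alpha> (k - 1) - Wx \<alpha> k) / (Wy \<alpha> (k - 1) - Wy \<alpha> k) \<in> bad"
          using \<alpha> k by (intro bad2) auto
      qed (use that in \<open>simp add: Vx_def algebra_simps\<close>)
      then show ?thesis by simp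
    qed
  qed
  have "Vx \<alpha> (k - 1) * Wy \<alpha> k - Wy \<alpha> (k - 1) * Vx \<alpha> k = Wx \<alpha> (k - 1) * Wy \<alpha> k - Wy \<alpha> (k - 1) * Wx \<alpha> k" for \<alpha> k
    by (simp add: Vx_def algebra_simps)
  \<comment> \<open>As \<open>\<kappa> < 1\<close>, the shear adds at most one copy of the other
    component. This produces the sum in the first factor of the bound.\<close>
  moreover have "(\<Sum>\<alpha>\<in>A. \<bar>Vx \<alpha> 0\<bar> + \<bar>Vx \<alpha> m\<bar>) \<le>
      (\<Sum>\<alpha>\<in>A. \<bar>Wx \<alpha> 0\<bar> + \<bar>Wx \<alpha> m\<bar>) + (\<Sum>\<alpha>\<in>A. \<bar>Wy \<alpha> 0\<bar> + \<bar>Wy \<alpha> m\<bar>)"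
  proof -
    have le: "\<bar>Vx \<alpha> k\<bar> \<le> \<bar>Wx \<alpha> k\<bar> + \<bar>Wy \<alpha> k\<bar>" for \<alpha> k
    proof -
      have "\<bar>\<kappa> * Wy \<alpha> k\<bar> \<le> \<bar>Wy \<alpha> k\<bar>" using \<kappa> by (simp add: abs_mult mult_left_le_one_le)
      then show ?thesis unfolding Vx_def by linarith
    qed
    have "\<bar>Vx \<alpha> 0\<bar> + \<bar>Vx \<alpha> m\<bar> \<le> (\<bar>Wx \<alpha> 0\<bar> + \<bar>Wx \<alpha> m\<bar>) + (\<bar>Wy \<alpha> 0\<bar> + \<bar>Wy \<alpha> m\<bar>)" for \<alpha>
      using le[of \<alpha> 0] le[of \<alpha> m] by linarith
    then show ?thesis unfolding sum.distrib[symmetric] by (intro sum_mono) (simp add: sum.distrib)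
  qed
  then have "24 * (\<Sum>\<alpha>\<in>A. \<bar>Vx \<alpha> 0\<bar> + \<bar>Vx \<alpha> m\<bar>) * (\<Sum>\<alpha>\<in>A. \<bar>Wy \<alpha> 0\<bar> + \<bar>Wy \<alpha> m\<bar>) \<le>
      24 * ((\<Sum>\<alpha>\<in>A. \<bar>Wx \<alpha> 0\<bar> + \<bar>Wx \<alpha> m\<bar>) + (\<Sum>\<alpha>\<in>A. \<bar>Wy \<alpha> 0\<bar> + \<bar>Wy \<alpha> m\<bar>)) *
      (\<Sum>\<alpha>\<in>A. \<bar>Wy \<alpha> 0\<bar> + \<bar>Wy \<alpha> m\<bar>)"
    by (intro mult_right_mono) (auto intro: sum_nonneg)
  ultimately show ?thesis using est by (simp only:)
qed

section \<open>The collision sequence of a motion\<close>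

lemma constant_velocity_affine:
  fixes x :: "real \<Rightarrow> real ^ 'n"
  assumes "continuous_on {0<..} x" "\<And>u. u \<in> {s<..<t} \<Longrightarrow> (x has_vector_derivative v) (at u)"
    and "0 < r" "s \<le> r" "r \<le> r'" "r' \<le> t"
  shows "x r' = x r + (r' - r) *\<^sub>R v"
proof -
  have "x r' - r' *\<^sub>R v = x r - r *\<^sub>R v"
  proof (rule has_derivative_zero_unique_strong_convex[of "{r..r'}" "{r, r'}" "\<lambda>u. x u - u *\<^sub>R v" r])
    show "continuous_on {r..r'} (\<lambda>u. x u - u *\<^sub>R v)"
      using assms by (intro continuous_intros continuous_on_subset[OF assms(1)]) auto
    fix u assume u: "u \<in> {r..r'} - {r, r'}"
    then have "u \<in> {s<..<t}" using assms by auto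
    then have "(x has_vector_derivative v) (at u within {r..r'})"
      by (rule assms(2)[THEN has_vector_derivative_at_within])
    then have "((\<lambda>u. x u - u *\<^sub>R v) has_vector_derivative v - 1 *\<^sub>R v) (at u within {r..r'})"
      by (auto intro!: derivative_eq_intros)
    then show "((\<lambda>u. x u - u *\<^sub>R v) has_derivative (\<lambda>h. 0)) (at u within {r..r'})"
      by (simp add: has_vector_derivative_def)
  qed (use assms in auto)
  then show ?thesis by (simp add: algebra_simps)
qed

text \<open>The case \<open>s = r\<close> is allowed and gives the velocity just after a collision
  at time \<open>s\<close>.\<close>

lemma vel_after_eq:
  fixes x :: "real \<Rightarrow> real ^ 'n"
  assumes "continuous_on {0<..} x" "\<And>u. u \<in> {s<..<t} \<Longrightarrow> (x has_vector_derivative v) (at u)"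
    and r: "0 < r" "s \<le> r" "r < t"
  shows "vel_after x r = v"
  unfolding vel_after_def
proof (rule vector_derivative_within)
  show "at_right r \<noteq> bot" by simp
  have "((\<lambda>u. x r + (u - r) *\<^sub>R v) has_vector_derivative v) (at_right r)"
    by (auto intro!: derivative_eq_intros)
  moreover have "eventually (\<lambda>u. u \<in> {r<..<t}) (at_right r)"
    using r(3) by (rule eventually_at_right_real)
  then have "eventually (\<lambda>u. x r + (u - r) *\<^sub>R v = x u) (at_right r)"
  proof eventually_elim
    case (elim u)
    then show ?case
      using constant_velocity_affine[OF assms(1,2) r(1,2), of t u] by auto
  qed
  ultimately show "(x has_vector_derivative v) (at_right r)"
    by (subst has_vector_derivative_cong_ev[symmetric]) (auto simp: eventually_at_filter elim: eventually_mono)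
qed

lemma vel_before_eq:
  fixes x :: "real \<Rightarrow> real ^ 'n"
  assumes "continuous_on {0<..} x" "\<And>u. u \<in> {s<..<t} \<Longrightarrow> (x has_vector_derivative v) (at u)"
    and r: "0 \<le> s" "s < r" "r \<le> t"
  shows "vel_before x r = v"
  unfolding vel_before_def
proof (rule vector_derivative_within)
  show "at_left r \<noteq> bot" by simp
  have "((\<lambda>u. x r - (r - u) *\<^sub>R v) has_vector_derivative v) (at_left r)"
    by (auto intro!: derivative_eq_intros)
  moreover have "eventually (\<lambda>u. u \<in> {s<..<r}) (at_left r)"
    using r(2) by (rule eventually_at_left_real)
  then have "eventually (\<lambda>u. x r - (r - u) *\<^sub>R v = x u) (at_left r)"
  proof eventually_elim
    case (elim u)
    then have "x r = x u + (r - u) *\<^sub>R v"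
      using r by (intro constant_velocity_affine[where s = s and t = t, OF assms(1,2)]) auto
    then show ?case by simp
  qed
  ultimately show "(x has_vector_derivative v) (at_left r)"
    by (subst has_vector_derivative_cong_ev[symmetric]) (auto simp: eventually_at_filter elim: eventually_mono)
qed

text \<open>The entries 0 and \<open>T\<close> at the ends let the stretches without collisions be
  indexed by 0 to \<open>m\<close>. The induction hypothesis is applied with the largest time
  \<open>b\<close> as upper bound, so that \<open>b\<close> is already the last entry, and
  \<open>T\<close> is appended.\<close>

lemma enumerate_times:
  fixes C :: "real set"
  assumes "finite C" "C \<subseteq> {0<..<T}" "0 < T"
  shows "\<exists>(m::nat) \<tau>. \<tau> 0 = 0 \<and> \<tau> (Suc m) = T \<and> \<tau> ` {1..m} = C \<and>
    (\<forall>k\<le>m. \<tau> k < \<tau> (Suc k) \<and> {\<tau> k<..<\<tau> (Suc k)} \<inter> C = {})"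
  using assms
proof (induction C arbitrary: T rule: finite_linorder_max_induct)
  case empty
  then show ?case by (intro exI[of _ 0] exI[of _ "\<lambda>k. if k = 0 then 0 else T"]) auto
next
  case (insert b C)
  then obtain m \<tau> where IH: "\<tau> 0 = 0" "\<tau> (Suc m) = b" "\<tau> ` {1..m} = C"
    "\<forall>k\<le>m. \<tau> k < \<tau> (Suc k) \<and> {\<tau> k<..<\<tau> (Suc k)} \<inter> C = {}"
    by (metis (no_types, lifting) greaterThanLessThan_iff insert_subset subsetI subset_iff)
  define \<tau>' where "\<tau>' = \<tau>(Suc (Suc m) := T)"
  have "\<tau>' ` {1..Suc m} = \<tau> ` insert (Suc m) {1..m}"
    by (intro image_cong) (auto simp: \<tau>'_def)
  then have "\<tau>' ` {1..Suc m} = insert b C" using IH by auto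
  moreover have "\<tau>' k < \<tau>' (Suc k) \<and> {\<tau>' k<..<\<tau>' (Suc k)} \<inter> insert b C = {}" if k: "k \<le> Suc m" for k
  proof (cases "k = Suc m")
    case True
    have "b < T" "{b<..<T} \<inter> insert b C = {}"
      using insert.prems(1) insert.hyps(2) by fastforce+
    then show ?thesis using IH(2) True by (simp add: \<tau>'_def)
  next
    case False
    then have k: "k \<le> m" using k by simp
    have "\<tau> (Suc k) \<le> b"
    proof (cases "k = m")
      case False
      then have "\<tau> (Suc k) \<in> \<tau> ` {1..m}" using k by (intro imageI) auto
      then show ?thesis unfolding IH(3) using insert.hyps(2) by (simp add: less_imp_le)
    qed (simp add: IH(2))
    then have "b \<notin> {\<tau> k<..<\<tau> (Suc k)}" by auto
    moreover have "\<tau> k < \<tau> (Suc k)" "{\<tau> k<..<\<tau> (Suc k)} \<inter> C = {}" using IH(4) k by blast+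
    ultimately show ?thesis using k by (simp add: \<tau>'_def)
  qed
  moreover have "\<tau>' 0 = 0" "\<tau>' (Suc (Suc m)) = T" by (auto simp: \<tau>'_def IH)
  ultimately show ?case by blast
qed

section \<open>Collision partners and the direction of the impulse\<close>

lemma collide_sym: "collide N a y t \<alpha> \<beta> \<Longrightarrow> collide N a y t \<beta> \<alpha>"
proof -
  have "(v - w) \<bullet> (x - z) = (w - v) \<bullet> (z - x)" for v w x z :: "real ^ 'n"
    by (simp add: inner_diff_left inner_diff_right)
  moreover assume "collide N a y t \<alpha> \<beta>"
  ultimately show ?thesis unfolding collide_def by (metis norm_minus_commute)
qed

text \<open>A particle without a collision at time \<open>t\<close> is its own partner, which makes
  this an involution of all particles.\<close>

definition partner :: "nat \<Rightarrow> real \<Rightarrow> (nat \<Rightarrow> real \<Rightarrow> real ^ 'n) \<Rightarrow> real \<Rightarrow> nat \<Rightarrow> nat" where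
  "partner N a y t \<alpha> = (if \<exists>\<beta>. collide N a y t \<alpha> \<beta> then SOME \<beta>. collide N a y t \<alpha> \<beta> else \<alpha>)"

lemma partner_collide: "collide N a y t \<alpha> \<beta> \<Longrightarrow> collide N a y t \<alpha> (partner N a y t \<alpha>)"
  unfolding partner_def by (auto intro: someI)

lemma collide_unique:
  assumes "only_binary_collisions N a y" "collide N a y t \<alpha> \<beta>" "collide N a y t \<alpha> \<gamma>"
  shows "\<beta> = \<gamma>"
  using assms unfolding only_binary_collisions_def binary_collision_def
  by (metis collide_def)

lemma partner_eq:
  assumes "only_binary_collisions N a y" "collide N a y t \<alpha> \<beta>"
  shows "partner N a y t \<alpha> = \<beta>"
  using collide_unique[OF assms(1)] partner_collide assms(2) by blast

lemma partner_involution: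
  assumes "only_binary_collisions N a y" "\<alpha> \<in> {1..N}"
  shows "partner N a y t \<alpha> \<in> {1..N} \<and> partner N a y t (partner N a y t \<alpha>) = \<alpha>"
proof (cases "\<exists>\<beta>. collide N a y t \<alpha> \<beta>")
  case True
  then obtain \<beta> where \<beta>: "collide N a y t \<alpha> \<beta>" by blast
  then show ?thesis
    using partner_eq[OF assms(1) \<beta>] partner_eq[OF assms(1) collide_sym[OF \<beta>]] by (auto simp: collide_def)
qed (use assms in \<open>auto simp: partner_def\<close>)

text \<open>By momentum conservation the relative velocity changes by -2 times the change of
  velocity of \<alpha>. Its component along the line of centers goes from negative to positive, so
  the contact force is repulsive. This is the source of the tension in the contact edges.\<close>

lemma collision_impulse:
  fixes y :: "nat \<Rightarrow> real \<Rightarrow> real ^ 'n"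
  assumes "hard_sphere_motion N a y" "only_binary_collisions N a y" "collide N a y t \<alpha> \<beta>"
  shows "\<exists>\<kappa>\<ge>0. vel_before (y \<alpha>) t - vel_after (y \<alpha>) t = \<kappa> *\<^sub>R (y \<beta> t - y \<alpha> t)"
proof -
  let ?n = "y \<beta> t - y \<alpha> t"
  have law: "collision_law y t \<alpha> \<beta>"
    using assms unfolding hard_sphere_motion_def only_binary_collisions_def by blast
  then obtain k where k: "vel_after (y \<alpha>) t - vel_before (y \<alpha>) t = k *\<^sub>R ?n"
    and mom: "vel_after (y \<alpha>) t + vel_after (y \<beta>) t = vel_before (y \<alpha>) t + vel_before (y \<beta>) t"
    unfolding collision_law_def by blast
  have "(vel_after (y \<beta>) t - vel_after (y \<alpha>) t) - (vel_before (y \<beta>) t - vel_before (y \<alpha>) t) =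
      - 2 *\<^sub>R (vel_after (y \<alpha>) t - vel_before (y \<alpha>) t)"
    using mom by (simp add: scaleR_2 algebra_simps)
  then have "((vel_after (y \<beta>) t - vel_after (y \<alpha>) t) - (vel_before (y \<beta>) t - vel_before (y \<alpha>) t)) \<bullet> ?n =
      - 2 * (k * (?n \<bullet> ?n))"
    unfolding k by (simp only: inner_scaleR_left)
  then have "(vel_after (y \<beta>) t - vel_after (y \<alpha>) t) \<bullet> ?n - (vel_before (y \<beta>) t - vel_before (y \<alpha>) t) \<bullet> ?n =
      - 2 * (k * (?n \<bullet> ?n))"
    by (simp only: inner_diff_left[of "_ - _" "_ - _"])
  moreover have "(vel_after (y \<beta>) t - vel_after (y \<alpha>) t) \<bullet> ?n > 0" "(vel_before (y \<beta>) t - vel_before (y \<alpha>) t) \<bullet> ?n < 0"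
    using assms(3) by (auto simp: collide_def)
  ultimately have "k * (?n \<bullet> ?n) < 0" by linarith
  then have "k \<le> 0" using inner_ge_zero[of ?n] by (auto simp: mult_less_0_iff)
  then show ?thesis using k by (intro exI[of _ "-k"]) (auto simp: algebra_simps)
qed

text \<open>Turns the motion up to time \<open>T\<close> into the finite data of a framework. Every
  particle gets a node at every collision time, even where it does not collide itself, so that all
  trajectories share one index set.\<close>

lemma motion_discretization:
  fixes y :: "nat \<Rightarrow> real \<Rightarrow> real ^ 'n" and a vbar t\<^sub>0 T :: real
  assumes N: "N > 0" and motion: "hard_sphere_motion N a y"
    and lf: "locally_finite_collisions N a y" and bin: "only_binary_collisions N a y"
    and t0: "0 < t\<^sub>0" "t\<^sub>0 < T" and vbar: "vbar = rms_velocity N y t\<^sub>0"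
  obtains m :: nat and \<tau> :: "nat \<Rightarrow> real" and V :: "nat \<Rightarrow> nat \<Rightarrow> real ^ 'n" and kap :: "nat \<Rightarrow> nat \<Rightarrow> real"
  where "\<And>k. k \<le> m \<Longrightarrow> \<tau> k < \<tau> (Suc k)"
    and "\<tau> ` {1..m} = {t. 0 < t \<and> t < T \<and> (\<exists>\<alpha> \<beta>. collide N a y t \<alpha> \<beta>)}"
    and "\<And>\<alpha> k. \<alpha> \<in> {1..N} \<Longrightarrow> k \<in> {1..m} \<Longrightarrow> vel_before (y \<alpha>) (\<tau> k) = V \<alpha> (k - 1)"
    and "\<And>\<alpha> k. \<alpha> \<in> {1..N} \<Longrightarrow> k \<in> {1..m} \<Longrightarrow> vel_after (y \<alpha>) (\<tau> k) = V \<alpha> k"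
    and "\<And>\<alpha> k. \<alpha> \<in> {1..N} \<Longrightarrow> k \<in> {1..m} \<Longrightarrow>
      y \<alpha> (\<tau> (Suc k)) - y \<alpha> (\<tau> k) = (\<tau> (Suc k) - \<tau> k) *\<^sub>R V \<alpha> k"
    and "\<And>\<alpha> k. \<alpha> \<in> {1..N} \<Longrightarrow> k \<in> {1..m} \<Longrightarrow> kap \<alpha> k \<ge> 0"
    and "\<And>\<alpha> k. \<alpha> \<in> {1..N} \<Longrightarrow> k \<in> {1..m} \<Longrightarrow>
      V \<alpha> (k - 1) - V \<alpha> k = kap \<alpha> k *\<^sub>R (y (partner N a y (\<tau> k) \<alpha>) (\<tau> k) - y \<alpha> (\<tau> k))"
    and "\<And>\<alpha> k. \<alpha> \<in> {1..N} \<Longrightarrow> k \<in> {1..m} \<Longrightarrow>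
      V (partner N a y (\<tau> k) \<alpha>) (k - 1) - V (partner N a y (\<tau> k) \<alpha>) k = - (V \<alpha> (k - 1) - V \<alpha> k)"
    and "\<And>k. k \<le> m \<Longrightarrow> (\<Sum>\<alpha>\<in>{1..N}. (norm (V \<alpha> k))\<^sup>2) = N * vbar\<^sup>2"
proof -
  define C where "C = {t. 0 < t \<and> t < T \<and> (\<exists>\<alpha> \<beta>. collide N a y t \<alpha> \<beta>)}"
  have "T > 0" using t0 by simp
  have "C \<subseteq> fst ` {(t, S) \<in> collisions N a y. 0 < t \<and> t < T}"
  proof
    fix t assume "t \<in> C"
    then obtain \<alpha> \<beta> where "0 < t" "t < T" "(t, {\<alpha>, \<beta>}) \<in> collisions N a y"
      unfolding C_def collisions_def by blast
    then show "t \<in> fst ` {(t, S) \<in> collisions N a y. 0 < t \<and> t < T}"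
      by (intro image_eqI[of _ _ "(t, {\<alpha>, \<beta>})"]) auto
  qed
  moreover have "finite {(t, S) \<in> collisions N a y. 0 < t \<and> t < T}"
    using lf \<open>T > 0\<close> unfolding locally_finite_collisions_def by blast
  ultimately have "finite C" by (meson finite_imageI finite_subset)
  moreover have "C \<subseteq> {0<..<T}" by (auto simp: C_def)
  ultimately obtain m \<tau> where \<tau>0: "\<tau> 0 = 0" and \<tau>T: "\<tau> (Suc m) = T" and \<tau>C: "\<tau> ` {1..m} = C"
    and step: "\<And>k. k \<le> m \<Longrightarrow> \<tau> k < \<tau> (Suc k)" and gap: "\<And>k. k \<le> m \<Longrightarrow> {\<tau> k<..<\<tau> (Suc k)} \<inter> C = {}"
    using enumerate_times[of C T] \<open>T > 0\<close> by blast
  have \<tau>_bounds: "0 \<le> \<tau> k \<and> \<tau> k < T" if "k \<le> m" for k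
  proof (cases "k = 0")
    case False
    then have "\<tau> k \<in> \<tau> ` {1..m}" using that by (intro imageI) auto
    then have "\<tau> k \<in> C" unfolding \<tau>C .
    then show ?thesis by (auto simp: C_def)
  qed (use \<tau>0 \<open>T > 0\<close> in simp)
  have \<tau>_le: "\<tau> (Suc k) \<le> T" if "k \<le> m" for k
    using \<tau>T \<tau>_bounds[of "Suc k"] that by (cases "k = m") auto
  have cont: "continuous_on {0<..} (y \<alpha>)" if "\<alpha> \<in> {1..N}" for \<alpha>
    using motion that unfolding hard_sphere_motion_def by blast
  have free: "\<exists>v. \<forall>u\<in>{s<..<t}. (y \<alpha> has_vector_derivative v) (at u)"
    if "\<alpha> \<in> {1..N}" "0 \<le> s" "s < t" "\<And>u \<beta>. u \<in> {s<..<t} \<Longrightarrow> \<not> collide N a y u \<alpha> \<beta>" for \<alpha> s t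
    using motion that unfolding hard_sphere_motion_def by blast
  have no_coll: "\<not> collide N a y u \<alpha> \<beta>" if "k \<le> m" "u \<in> {\<tau> k<..<\<tau> (Suc k)}" for k u \<alpha> \<beta>
    using that gap[of k] \<tau>_bounds[of k] \<tau>_le[of k] by (auto simp: C_def disjoint_iff)
  define V where "V \<alpha> k = (SOME v. \<forall>u\<in>{\<tau> k<..<\<tau> (Suc k)}. (y \<alpha> has_vector_derivative v) (at u))" for \<alpha> k
  have V: "(y \<alpha> has_vector_derivative V \<alpha> k) (at u)" if "\<alpha> \<in> {1..N}" "k \<le> m" "u \<in> {\<tau> k<..<\<tau> (Suc k)}" for \<alpha> k u
  proof -
    have "\<exists>v. \<forall>u\<in>{\<tau> k<..<\<tau> (Suc k)}. (y \<alpha> has_vector_derivative v) (at u)"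
      using that \<tau>_bounds step no_coll by (intro free) auto
    from someI_ex[OF this] show ?thesis using that(3) unfolding V_def by blast
  qed
  have after: "vel_after (y \<alpha>) t = V \<alpha> k" if "\<alpha> \<in> {1..N}" "k \<le> m" "0 < t" "\<tau> k \<le> t" "t < \<tau> (Suc k)" for \<alpha> k t
    using that by (intro vel_after_eq[OF cont V, where s = "\<tau> k" and t = "\<tau> (Suc k)"]) auto
  have before: "vel_before (y \<alpha>) (\<tau> k) = V \<alpha> (k - 1)" if \<alpha>: "\<alpha> \<in> {1..N}" and k: "k \<in> {1..m}" for \<alpha> k
  proof -
    obtain j where j: "k = Suc j" using k by (cases k) auto
    show ?thesis
      using \<alpha> k \<tau>_bounds[of j] step[of j] j
      by (intro vel_before_eq[OF cont V, where s = "\<tau> j" and t = "\<tau> (Suc j)"]) auto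
  qed
  have \<tau>_pos: "0 < \<tau> k" if "k \<in> {1..m}" for k
  proof -
    have "\<tau> k \<in> C" using that \<tau>C by blast
    then show ?thesis by (simp add: C_def)
  qed
  have after': "vel_after (y \<alpha>) (\<tau> k) = V \<alpha> k" if "\<alpha> \<in> {1..N}" "k \<in> {1..m}" for \<alpha> k
    using that \<tau>_pos step by (intro after) auto
  have flight: "y \<alpha> (\<tau> (Suc k)) - y \<alpha> (\<tau> k) = (\<tau> (Suc k) - \<tau> k) *\<^sub>R V \<alpha> k"
    if "\<alpha> \<in> {1..N}" "k \<in> {1..m}" for \<alpha> k
  proof -
    have "y \<alpha> (\<tau> (Suc k)) = y \<alpha> (\<tau> k) + (\<tau> (Suc k) - \<tau> k) *\<^sub>R V \<alpha> k"
      using that \<tau>_pos[of k] step[of k]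
      by (intro constant_velocity_affine[OF cont V, where s = "\<tau> k" and t = "\<tau> (Suc k)"]) auto
    then show ?thesis by simp
  qed
  \<comment> \<open>Without a collision of \<alpha> at \<open>\<tau> k\<close>, the law of free
    flight applies to the union of the two adjacent stretches and provides a single
    velocity.\<close>
  have lonely: "V \<alpha> (k - 1) = V \<alpha> k" if \<alpha>: "\<alpha> \<in> {1..N}" and k: "k \<in> {1..m}" and "\<nexists>\<beta>. collide N a y (\<tau> k) \<alpha> \<beta>" for \<alpha> k
  proof -
    obtain j where j: "k = Suc j" using k by (cases k) auto
    have "\<exists>v. \<forall>u\<in>{\<tau> j<..<\<tau> (Suc k)}. (y \<alpha> has_vector_derivative v) (at u)"
    proof (rule free[OF \<alpha>])
      show "0 \<le> \<tau> j" "\<tau> j < \<tau> (Suc k)" using \<tau>_bounds[of j] step[of j] step[of k] k j by auto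
      fix u \<beta> assume "u \<in> {\<tau> j<..<\<tau> (Suc k)}"
      then have "u \<in> {\<tau> j<..<\<tau> (Suc j)} \<or> u = \<tau> k \<or> u \<in> {\<tau> k<..<\<tau> (Suc k)}" using j by auto
      then show "\<not> collide N a y u \<alpha> \<beta>" using that(3) no_coll[of j u] no_coll[of k u] k j by auto
    qed
    then obtain v where v: "\<And>u. u \<in> {\<tau> j<..<\<tau> (Suc k)} \<Longrightarrow> (y \<alpha> has_vector_derivative v) (at u)" by blast
    have "V \<alpha> i = v" if i: "i = j \<or> i = k" for i
    proof -
      have im: "i \<le> m" using i j k by auto
      obtain u where u: "\<tau> i < u" "u < \<tau> (Suc i)" using step[OF im] dense by blast
      then have "u \<in> {\<tau> j<..<\<tau> (Suc k)}" using i j k step[of j] step[of k] by auto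
      then show ?thesis using V[OF \<alpha> im, of u] v[of u] u vector_derivative_unique_at by auto
    qed
    then show ?thesis using j by simp
  qed
  have law: "collision_law y (\<tau> k) \<alpha> \<beta>" if "collide N a y (\<tau> k) \<alpha> \<beta>" for \<alpha> \<beta> k
    using motion bin that unfolding hard_sphere_motion_def only_binary_collisions_def by blast
  have partner_cases: "(partner N a y (\<tau> k) \<alpha> = \<alpha> \<and> V \<alpha> (k - 1) = V \<alpha> k) \<or>
      collide N a y (\<tau> k) \<alpha> (partner N a y (\<tau> k) \<alpha>)" if "\<alpha> \<in> {1..N}" "k \<in> {1..m}" for \<alpha> k
    using lonely[OF that] partner_collide unfolding partner_def by metis
  \<comment> \<open>If the particle is its own partner, both sides are zero.\<close>
  have "\<exists>\<kappa>\<ge>0. V \<alpha> (k - 1) - V \<alpha> k = \<kappa> *\<^sub>R (y (partner N a y (\<tau> k) \<alpha>) (\<tau> k) - y \<alpha> (\<tau> k))"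
    if "\<alpha> \<in> {1..N}" "k \<in> {1..m}" for \<alpha> k
    using partner_cases[OF that] collision_impulse[OF motion bin] before[OF that] after'[OF that] by fastforce
  then obtain kap where kap: "\<And>\<alpha> k. \<alpha> \<in> {1..N} \<Longrightarrow> k \<in> {1..m} \<Longrightarrow> kap \<alpha> k \<ge> 0 \<and>
      V \<alpha> (k - 1) - V \<alpha> k = kap \<alpha> k *\<^sub>R (y (partner N a y (\<tau> k) \<alpha>) (\<tau> k) - y \<alpha> (\<tau> k))"
    by metis
  have conserved: "V (partner N a y (\<tau> k) \<alpha>) (k - 1) - V (partner N a y (\<tau> k) \<alpha>) k = - (V \<alpha> (k - 1) - V \<alpha> k) \<and>
      (norm (V (partner N a y (\<tau> k) \<alpha>) (k - 1)))\<^sup>2 - (norm (V (partner N a y (\<tau> k) \<alpha>) k))\<^sup>2 =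
      - ((norm (V \<alpha> (k - 1)))\<^sup>2 - (norm (V \<alpha> k))\<^sup>2)"
    if "\<alpha> \<in> {1..N}" "k \<in> {1..m}" for \<alpha> k
    using partner_cases[OF that]
  proof
    let ?\<beta> = "partner N a y (\<tau> k) \<alpha>"
    assume c: "collide N a y (\<tau> k) \<alpha> ?\<beta>"
    then have \<beta>: "?\<beta> \<in> {1..N}" by (simp add: collide_def)
    have "V \<alpha> k + V ?\<beta> k = V \<alpha> (k - 1) + V ?\<beta> (k - 1)"
      "(norm (V \<alpha> k))\<^sup>2 + (norm (V ?\<beta> k))\<^sup>2 = (norm (V \<alpha> (k - 1)))\<^sup>2 + (norm (V ?\<beta> (k - 1)))\<^sup>2"
      using law[OF c] before[OF that] after'[OF that] before[OF \<beta> that(2)] after'[OF \<beta> that(2)]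
      unfolding collision_law_def by auto
    then show ?thesis by (auto simp: algebra_simps)
  qed auto
  have energy_step: "(\<Sum>\<alpha>\<in>{1..N}. (norm (V \<alpha> (k - 1)))\<^sup>2) = (\<Sum>\<alpha>\<in>{1..N}. (norm (V \<alpha> k))\<^sup>2)" if k: "k \<in> {1..m}" for k
  proof -
    define d where "d \<alpha> = (norm (V \<alpha> (k - 1)))\<^sup>2 - (norm (V \<alpha> k))\<^sup>2" for \<alpha>
    \<comment> \<open>Partners have opposite energy changes, so the sum equals its own
      negative.\<close>
    have "(\<Sum>\<alpha>\<in>{1..N}. d \<alpha>) = (\<Sum>\<alpha>\<in>{1..N}. d (partner N a y (\<tau> k) \<alpha>))"
      by (rule sum.reindex_bij_witness[of _ "partner N a y (\<tau> k)" "partner N a y (\<tau> k)"])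
        (use partner_involution[OF bin] in auto)
    also have "\<dots> = (\<Sum>\<alpha>\<in>{1..N}. - d \<alpha>)"
      using conserved k by (intro sum.cong refl) (auto simp: d_def)
    finally have "(\<Sum>\<alpha>\<in>{1..N}. d \<alpha>) = 0" by (simp add: sum_negf)
    then show ?thesis by (simp add: d_def sum_subtractf)
  qed
  have energy0: "(\<Sum>\<alpha>\<in>{1..N}. (norm (V \<alpha> k))\<^sup>2) = (\<Sum>\<alpha>\<in>{1..N}. (norm (V \<alpha> 0))\<^sup>2)" if "k \<le> m" for k
    using that
  proof (induction k)
    case (Suc k)
    then show ?case using energy_step[of "Suc k"] by simp
  qed simp
  \<comment> \<open>The stretch that contains \<open>t\<^sub>0\<close> links the energy read at that
    time to the velocities \<open>V\<close>.\<close>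
  have "\<exists>j\<le>m. \<tau> j \<le> t\<^sub>0 \<and> t\<^sub>0 < \<tau> (Suc j)"
  proof -
    define j where "j = (GREATEST j. j \<le> m \<and> \<tau> j \<le> t\<^sub>0)"
    have j: "j \<le> m \<and> \<tau> j \<le> t\<^sub>0"
      unfolding j_def by (rule GreatestI_nat[of _ 0 m]) (use \<tau>0 t0 in auto)
    moreover have "t\<^sub>0 < \<tau> (Suc j)"
    proof (rule ccontr)
      assume *: "\<not> t\<^sub>0 < \<tau> (Suc j)"
      then have "Suc j \<le> m" using j \<tau>T t0 by (cases "j = m") auto
      then have "Suc j \<le> j"
        unfolding j_def using * j_def by (intro Greatest_le_nat[of _ _ m]) auto
      then show False by simp
    qed
    ultimately show ?thesis by blast
  qed
  then obtain j where j: "j \<le> m" "\<tau> j \<le> t\<^sub>0" "t\<^sub>0 < \<tau> (Suc j)" by blast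
  have "2 * total_energy N y t\<^sub>0 = (\<Sum>\<alpha>\<in>{1..N}. (norm (V \<alpha> j))\<^sup>2)"
    unfolding total_energy_def sum_distrib_left using j t0 after by (intro sum.cong refl) auto
  moreover have "vbar\<^sup>2 = 2 * total_energy N y t\<^sub>0 / N"
    unfolding vbar rms_velocity_def calculation by (intro real_sqrt_pow2 divide_nonneg_nonneg sum_nonneg) auto
  ultimately have energy: "(\<Sum>\<alpha>\<in>{1..N}. (norm (V \<alpha> k))\<^sup>2) = N * vbar\<^sup>2" if "k \<le> m" for k
    using energy0[OF that] energy0[OF j(1)] N by simp
  show ?thesis
  proof (rule that[of m \<tau> V kap])
    show "\<tau> ` {1..m} = {t. 0 < t \<and> t < T \<and> (\<exists>\<alpha> \<beta>. collide N a y t \<alpha> \<beta>)}"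
      using \<tau>C unfolding C_def .
  qed (fact step before after' flight kap[THEN conjunct1] kap[THEN conjunct2] conserved[THEN conjunct1] energy)+
qed

section \<open>The estimate\<close>

text \<open>By the identity of Lagrange the squares of the 2 x 2 minors, summed over ordered index
  pairs, give twice the squared wedge norm. The Euclidean norm of the minors is then bounded by
  their absolute sum.\<close>

lemma wedge_norm_le:
  fixes v w :: "real ^ 'n"
  shows "wedge_norm v w \<le> (\<Sum>i\<in>UNIV. \<Sum>j\<in>UNIV. \<bar>v $ i * w $ j - v $ j * w $ i\<bar>)"
proof -
  let ?f = "\<lambda>(i, j). v $ i * w $ j - v $ j * w $ i"
  have sq: "(norm x)\<^sup>2 = (\<Sum>i\<in>UNIV. (x $ i)\<^sup>2)" for x :: "real ^ 'n"
    unfolding power2_norm_eq_inner inner_vec_def by (simp add: power2_eq_square)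
  have "(\<Sum>p\<in>UNIV. (?f p)\<^sup>2) = (\<Sum>i\<in>UNIV. \<Sum>j\<in>UNIV. (v $ i * w $ j - v $ j * w $ i)\<^sup>2)"
    by (simp add: UNIV_Times_UNIV[symmetric] sum.cartesian_product case_prod_unfold del: UNIV_Times_UNIV)
  also have "\<dots> = (\<Sum>i\<in>UNIV. \<Sum>j\<in>UNIV. (v $ i)\<^sup>2 * (w $ j)\<^sup>2) + (\<Sum>i\<in>UNIV. \<Sum>j\<in>UNIV. (w $ i)\<^sup>2 * (v $ j)\<^sup>2)
      - 2 * (\<Sum>i\<in>UNIV. \<Sum>j\<in>UNIV. (v $ i * w $ i) * (v $ j * w $ j))"
    unfolding sum_distrib_left sum.distrib[symmetric] sum_subtractf[symmetric]
    by (intro sum.cong refl) (simp add: power2_diff power_mult_distrib algebra_simps)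
  also have "\<dots> = 2 * ((norm v)\<^sup>2 * (norm w)\<^sup>2 - (v \<bullet> w)\<^sup>2)"
    unfolding sum_product[symmetric] sq by (simp add: inner_vec_def power2_eq_square)
  finally have S: "(\<Sum>p\<in>UNIV. (?f p)\<^sup>2) = 2 * ((norm v)\<^sup>2 * (norm w)\<^sup>2 - (v \<bullet> w)\<^sup>2)" .
  then have "(norm v)\<^sup>2 * (norm w)\<^sup>2 - (v \<bullet> w)\<^sup>2 \<le> (\<Sum>p\<in>UNIV. (?f p)\<^sup>2)"
    using sum_nonneg[of UNIV "\<lambda>p. (?f p)\<^sup>2"] by simp
  then have "wedge_norm v w \<le> L2_set ?f UNIV"
    unfolding wedge_norm_def L2_set_def by (rule real_sqrt_le_mono)
  also have "\<dots> \<le> (\<Sum>p\<in>UNIV. \<bar>?f p\<bar>)" by (rule L2_set_le_sum_abs)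
  also have "\<dots> = (\<Sum>i\<in>UNIV. \<Sum>j\<in>UNIV. \<bar>v $ i * w $ j - v $ j * w $ i\<bar>)"
    by (simp add: UNIV_Times_UNIV[symmetric] sum.cartesian_product case_prod_unfold del: UNIV_Times_UNIV)
  finally show ?thesis .
qed

lemma kink_collide:
  assumes "(\<alpha>, t, S) \<in> kinks N a y"
  obtains \<beta> where "collide N a y t \<alpha> \<beta>" "S = {\<alpha>, \<beta>}"
proof -
  obtain \<gamma> \<delta> where "collide N a y t \<gamma> \<delta>" "S = {\<gamma>, \<delta>}" "\<alpha> \<in> {\<gamma>, \<delta>}"
    using assms by (auto simp: kinks_def collisions_def)
  then show ?thesis
    using that[of \<gamma>] that[of \<delta>] collide_sym by (metis empty_iff insert_commute insert_iff)
qed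

lemma kink_weight_nonneg:
  fixes y :: "nat \<Rightarrow> real \<Rightarrow> real ^ 'n"
  shows "vbar \<ge> 0 \<Longrightarrow> kink_weight vbar y k \<ge> 0"
proof -
  have "wedge_norm v w \<ge> 0" for v w :: "real ^ 'n"
    using Cauchy_Schwarz_ineq[of v w] by (simp add: wedge_norm_def power2_norm_eq_inner)
  then show "vbar \<ge> 0 \<Longrightarrow> kink_weight vbar y k \<ge> 0"
    by (simp add: kink_weight_def split: prod.split)
qed

lemma rms_velocity_nonneg: "rms_velocity N y t \<ge> 0"
  unfolding rms_velocity_def total_energy_def
  by (intro real_sqrt_ge_zero divide_nonneg_nonneg mult_nonneg_nonneg sum_nonneg) auto

text \<open>Each coordinate plane contributes at most 192 times the square of
  \<open>N * vbar\<close>. There are \<open>CARD('n)\<close> planes spanned by time and a space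
  axis, for the velocity jumps, and \<open>CARD('n)\<close> squared ordered pairs of space axes, for
  the wedge norms.\<close>

lemma finite_kink_sum_le:
  fixes y :: "nat \<Rightarrow> real \<Rightarrow> real ^ 'n"
  assumes N: "N > 0" and motion: "hard_sphere_motion N a y"
    and lf: "locally_finite_collisions N a y" and bin: "only_binary_collisions N a y"
    and t0: "0 < t\<^sub>0" and vbar: "vbar = rms_velocity N y t\<^sub>0"
    and F: "finite F" "F \<subseteq> kinks N a y"
  shows "(\<Sum>k\<in>F. kink_weight vbar y k) \<le> 192 * (CARD('n) + (CARD('n))\<^sup>2) * (real N)\<^sup>2 * vbar\<^sup>2"
proof -
  \<comment> \<open>A time strictly later than \<open>t\<^sub>0\<close> and all kinks in
    \<open>F\<close>.\<close>
  define T where "T = Max (insert t\<^sub>0 ((\<lambda>(\<alpha>, t, S). t) ` F)) + 1"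
  have T: "x < T" if "x \<in> insert t\<^sub>0 ((\<lambda>(\<alpha>, t, S). t) ` F)" for x
    using Max_ge[OF _ that] F(1) by (auto simp: T_def)
  have vbar0: "vbar \<ge> 0" unfolding vbar by (rule rms_velocity_nonneg)
  have "t\<^sub>0 < T" using T by simp
  obtain m \<tau> V kap
    where step: "\<And>k. k \<le> m \<Longrightarrow> \<tau> k < \<tau> (Suc k)"
    and times: "\<tau> ` {1..m} = {t. 0 < t \<and> t < T \<and> (\<exists>\<alpha> \<beta>. collide N a y t \<alpha> \<beta>)}"
    and before: "\<And>\<alpha> k. \<alpha> \<in> {1..N} \<Longrightarrow> k \<in> {1..m} \<Longrightarrow> vel_before (y \<alpha>) (\<tau> k) = V \<alpha> (k - 1)"
    and after: "\<And>\<alpha> k. \<alpha> \<in> {1..N} \<Longrightarrow> k \<in> {1..m} \<Longrightarrow> vel_after (y \<alpha>) (\<tau> k) = V \<alpha> k"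
    and flight: "\<And>\<alpha> k. \<alpha> \<in> {1..N} \<Longrightarrow> k \<in> {1..m} \<Longrightarrow>
      y \<alpha> (\<tau> (Suc k)) - y \<alpha> (\<tau> k) = (\<tau> (Suc k) - \<tau> k) *\<^sub>R V \<alpha> k"
    and kap: "\<And>\<alpha> k. \<alpha> \<in> {1..N} \<Longrightarrow> k \<in> {1..m} \<Longrightarrow> kap \<alpha> k \<ge> 0"
    and impulse: "\<And>\<alpha> k. \<alpha> \<in> {1..N} \<Longrightarrow> k \<in> {1..m} \<Longrightarrow>
      V \<alpha> (k - 1) - V \<alpha> k = kap \<alpha> k *\<^sub>R (y (partner N a y (\<tau> k) \<alpha>) (\<tau> k) - y \<alpha> (\<tau> k))"
    and momentum: "\<And>\<alpha> k. \<alpha> \<in> {1..N} \<Longrightarrow> k \<in> {1..m} \<Longrightarrow>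
      V (partner N a y (\<tau> k) \<alpha>) (k - 1) - V (partner N a y (\<tau> k) \<alpha>) k = - (V \<alpha> (k - 1) - V \<alpha> k)"
    and energy: "\<And>k. k \<le> m \<Longrightarrow> (\<Sum>\<alpha>\<in>{1..N}. (norm (V \<alpha> k))\<^sup>2) = N * vbar\<^sup>2"
    using motion_discretization[OF N motion lf bin t0 \<open>t\<^sub>0 < T\<close> vbar] by blast

  \<comment> \<open>\<open>None\<close> stands for the scaled time axis, on which every particle has
    the constant force component \<open>vbar\<close>, and \<open>Some i\<close> for a space
    axis.\<close>
  define Z where "Z c \<alpha> k = (case c of None \<Rightarrow> vbar * \<tau> k | Some i \<Rightarrow> y \<alpha> (\<tau> k) $ i)" for c :: "'n option" and \<alpha> k
  define W where "W c \<alpha> k = (case c of None \<Rightarrow> vbar | Some i \<Rightarrow> V \<alpha> k $ i)" for c :: "'n option" and \<alpha> k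
  have speed: "(\<Sum>\<alpha>\<in>{1..N}. \<bar>W c \<alpha> k\<bar>) \<le> N * vbar" if "k \<le> m" for c k
  proof (cases c)
    case None
    then show ?thesis using vbar0 by (simp add: W_def)
  next
    case (Some i)
    have "(\<Sum>\<alpha>\<in>{1..N}. \<bar>W c \<alpha> k\<bar>) \<le> (\<Sum>\<alpha>\<in>{1..N}. norm (V \<alpha> k))"
      by (intro sum_mono) (simp add: W_def Some component_le_norm_cart)
    also have "\<dots> \<le> N * vbar"
    \<comment> \<open>Cauchy-Schwarz bounds the sum of the speeds through the energy.\<close>
    proof (rule power2_le_imp_le)
      have "(\<Sum>\<alpha>\<in>{1..N}. norm (V \<alpha> k))\<^sup>2 \<le> (\<Sum>\<alpha>\<in>{1..N}. (norm (V \<alpha> k))\<^sup>2) * card {1..N}"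
        by (rule sum_squared_le_sum_of_squares)
      also have "\<dots> = (N * vbar)\<^sup>2"
        unfolding energy[OF that] by (simp add: power2_eq_square)
      finally show "(\<Sum>\<alpha>\<in>{1..N}. norm (V \<alpha> k))\<^sup>2 \<le> (N * vbar)\<^sup>2" .
    qed (use vbar0 in simp)
    finally show ?thesis .
  qed
  have plane: "(\<Sum>\<alpha>\<in>{1..N}. \<Sum>k\<in>{1..m}. \<bar>W c \<alpha> (k - 1) * W d \<alpha> k - W d \<alpha> (k - 1) * W c \<alpha> k\<bar>) \<le>
      192 * (real N)\<^sup>2 * vbar\<^sup>2" for c d
  proof -
    let ?M = "\<lambda>c. (\<Sum>\<alpha>\<in>{1..N}. \<bar>W c \<alpha> 0\<bar> + \<bar>W c \<alpha> m\<bar>)"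
    have free: "W e \<alpha> k = 1 / (\<tau> (Suc k) - \<tau> k) * (Z e \<alpha> (Suc k) - Z e \<alpha> k)"
      if "\<alpha> \<in> {1..N}" "k \<in> {1..<m}" for e \<alpha> k
    proof -
      have "Z e \<alpha> (Suc k) - Z e \<alpha> k = (\<tau> (Suc k) - \<tau> k) * W e \<alpha> k"
        using flight[of \<alpha> k] that
        by (cases e) (auto simp: Z_def W_def algebra_simps vec_eq_iff)
      then show ?thesis using step[of k] that by simp
    qed
    \<comment> \<open>On the time axis both sides vanish: the two centers are taken at the same
      time, and the force component is constant.\<close>
    have imp: "W e \<alpha> (k - 1) - W e \<alpha> k = kap \<alpha> k * (Z e (partner N a y (\<tau> k) \<alpha>) k - Z e \<alpha> k)"
      if "\<alpha> \<in> {1..N}" "k \<in> {1..m}" for e \<alpha> k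
      using arg_cong[OF impulse[OF that], of "\<lambda>x. x $ the e"]
      by (cases e) (auto simp: Z_def W_def)
    have mom: "W e (partner N a y (\<tau> k) \<alpha>) (k - 1) - W e (partner N a y (\<tau> k) \<alpha>) k = - (W e \<alpha> (k - 1) - W e \<alpha> k)"
      if "\<alpha> \<in> {1..N}" "k \<in> {1..m}" for e \<alpha> k
      using arg_cong[OF momentum[OF that], of "\<lambda>x. x $ the e"]
      by (cases e) (auto simp: W_def)
    have "(\<Sum>\<alpha>\<in>{1..N}. \<Sum>k\<in>{1..m}. \<bar>W c \<alpha> (k - 1) * W d \<alpha> k - W d \<alpha> (k - 1) * W c \<alpha> k\<bar>) \<le>
        24 * (?M c + ?M d) * ?M d"
    proof (rule planar_estimate[where lam = "\<lambda>\<alpha> k. 1 / (\<tau> (Suc k) - \<tau> k)" and kap = kap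
          and p = "\<lambda>k \<alpha>. partner N a y (\<tau> k) \<alpha>" and Zx = "Z c" and Zy = "Z d"])
      show "1 / (\<tau> (Suc k) - \<tau> k) \<ge> 0" if "k \<in> {1..<m}" for k
        using step[of k] that by simp
    qed (use free imp mom kap partner_involution[OF bin] in simp_all)
    \<comment> \<open>Each \<open>?M\<close> adds the forces of the first and the last flights, at
      most \<open>N * vbar\<close> each.\<close>
    also have "\<dots> \<le> 24 * (4 * (N * vbar)) * (2 * (N * vbar))"
    proof -
      have M: "?M e \<le> 2 * (N * vbar)" "0 \<le> ?M e" for e
        using speed[of 0 e] speed[of m e] by (auto simp: sum.distrib intro!: add_nonneg_nonneg sum_nonneg)
      then have "?M c + ?M d \<le> 4 * (N * vbar)" using M(1)[of c] M(1)[of d] by linarith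
      then show ?thesis using M vbar0 by (intro mult_mono) auto
    qed
    also have "\<dots> = 192 * (real N)\<^sup>2 * vbar\<^sup>2" by (simp add: power2_eq_square)
    finally show ?thesis .
  qed

  \<comment> \<open>The image of \<open>g\<close> covers \<open>F\<close>; particles without a
    collision at \<open>\<tau> k\<close> only add nonnegative terms.\<close>
  define g where "g = (\<lambda>(\<alpha>, k). (\<alpha>, \<tau> k, {\<alpha>, partner N a y (\<tau> k) \<alpha>}))"
  have "F \<subseteq> g ` ({1..N} \<times> {1..m})"
  proof
    fix x assume "x \<in> F"
    moreover obtain \<alpha> t S where x: "x = (\<alpha>, t, S)" by (cases x)
    ultimately have "t \<in> (\<lambda>(\<alpha>, t, S). t) ` F" "(\<alpha>, t, S) \<in> kinks N a y"
      using F(2) by (auto intro: image_eqI[of _ _ x])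
    then have "t < T" using T by blast
    obtain \<beta> where \<beta>: "collide N a y t \<alpha> \<beta>" "S = {\<alpha>, \<beta>}"
      using kink_collide[OF \<open>(\<alpha>, t, S) \<in> kinks N a y\<close>] .
    have "0 < t" using \<beta>(1) unfolding collide_def by (rule conjunct1)
    then have "t \<in> \<tau> ` {1..m}" unfolding times mem_Collect_eq using \<open>t < T\<close> \<beta>(1) by metis
    then obtain k where k: "k \<in> {1..m}" "t = \<tau> k" by blast
    have "x = g (\<alpha>, k)"
      using \<beta> partner_eq[OF bin \<beta>(1)] by (simp add: g_def x k(2))
    moreover have "(\<alpha>, k) \<in> {1..N} \<times> {1..m}" using \<beta>(1) k(1) by (simp add: collide_def)
    ultimately show "x \<in> g ` ({1..N} \<times> {1..m})" by (rule image_eqI)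
  qed
  then have "(\<Sum>k\<in>F. kink_weight vbar y k) \<le> (\<Sum>k\<in>g ` ({1..N} \<times> {1..m}). kink_weight vbar y k)"
    by (intro sum_mono2) (auto simp: kink_weight_nonneg vbar0)
  also have "\<dots> \<le> (\<Sum>(\<alpha>, k)\<in>{1..N} \<times> {1..m}. kink_weight vbar y (g (\<alpha>, k)))"
    using sum_image_le[of "{1..N} \<times> {1..m}" "kink_weight vbar y" g]
    by (simp add: kink_weight_nonneg vbar0 o_def case_prod_unfold)
  also have "\<dots> = (\<Sum>\<alpha>\<in>{1..N}. \<Sum>k\<in>{1..m}. kink_weight vbar y (g (\<alpha>, k)))"
    by (simp add: sum.cartesian_product)
  also have "\<dots> \<le> (\<Sum>\<alpha>\<in>{1..N}. \<Sum>k\<in>{1..m}.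
      (\<Sum>i\<in>UNIV. \<bar>W None \<alpha> (k - 1) * W (Some i) \<alpha> k - W (Some i) \<alpha> (k - 1) * W None \<alpha> k\<bar>) +
      (\<Sum>i\<in>UNIV. \<Sum>j\<in>UNIV. \<bar>W (Some i) \<alpha> (k - 1) * W (Some j) \<alpha> k - W (Some j) \<alpha> (k - 1) * W (Some i) \<alpha> k\<bar>))"
  proof (intro sum_mono)
    fix \<alpha> k assume *: "\<alpha> \<in> {1..N}" "k \<in> {1..m}"
    have "vbar * norm (V \<alpha> k - V \<alpha> (k - 1)) \<le> vbar * (\<Sum>i\<in>UNIV. \<bar>(V \<alpha> k - V \<alpha> (k - 1)) $ i\<bar>)"
      using vbar0 by (intro mult_left_mono norm_le_l1_cart)
    \<comment> \<open>Both forces have time component \<open>vbar\<close>, so their wedge product in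
      this plane is \<open>vbar\<close> times the jump of the space component.\<close>
    also have "\<dots> = (\<Sum>i\<in>UNIV. \<bar>W None \<alpha> (k - 1) * W (Some i) \<alpha> k - W (Some i) \<alpha> (k - 1) * W None \<alpha> k\<bar>)"
      unfolding sum_distrib_left
    proof (intro sum.cong refl)
      fix i
      have "W None \<alpha> (k - 1) * W (Some i) \<alpha> k - W (Some i) \<alpha> (k - 1) * W None \<alpha> k = vbar * (V \<alpha> k - V \<alpha> (k - 1)) $ i"
        by (simp add: W_def algebra_simps)
      then show "vbar * \<bar>(V \<alpha> k - V \<alpha> (k - 1)) $ i\<bar> = \<bar>W None \<alpha> (k - 1) * W (Some i) \<alpha> k - W (Some i) \<alpha> (k - 1) * W None \<alpha> k\<bar>"
        using vbar0 by (simp add: abs_mult)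
    qed
    finally show "kink_weight vbar y (g (\<alpha>, k)) \<le>
      (\<Sum>i\<in>UNIV. \<bar>W None \<alpha> (k - 1) * W (Some i) \<alpha> k - W (Some i) \<alpha> (k - 1) * W None \<alpha> k\<bar>) +
      (\<Sum>i\<in>UNIV. \<Sum>j\<in>UNIV. \<bar>W (Some i) \<alpha> (k - 1) * W (Some j) \<alpha> k - W (Some j) \<alpha> (k - 1) * W (Some i) \<alpha> k\<bar>)"
      using wedge_norm_le[of "V \<alpha> (k - 1)" "V \<alpha> k"] before[OF *] after[OF *]
      by (simp add: kink_weight_def g_def W_def)
  qed
  also have "\<dots> = (\<Sum>i\<in>UNIV. \<Sum>\<alpha>\<in>{1..N}. \<Sum>k\<in>{1..m}. \<bar>W None \<alpha> (k - 1) * W (Some i) \<alpha> k - W (Some i) \<alpha> (k - 1) * W None \<alpha> k\<bar>) +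
      (\<Sum>i\<in>UNIV. \<Sum>j\<in>UNIV. \<Sum>\<alpha>\<in>{1..N}. \<Sum>k\<in>{1..m}. \<bar>W (Some i) \<alpha> (k - 1) * W (Some j) \<alpha> k - W (Some j) \<alpha> (k - 1) * W (Some i) \<alpha> k\<bar>)"
    (is "_ = ?P + ?Q")
  proof -
    have swap: "(\<Sum>\<alpha>\<in>{1..N}. \<Sum>k\<in>{1..m}. \<Sum>i\<in>UNIV. f \<alpha> k i) = (\<Sum>i\<in>UNIV. \<Sum>\<alpha>\<in>{1..N}. \<Sum>k\<in>{1..m}. f \<alpha> k i)"
      for f :: "nat \<Rightarrow> nat \<Rightarrow> 'n \<Rightarrow> real"
    proof -
      have "(\<Sum>\<alpha>\<in>{1..N}. \<Sum>k\<in>{1..m}. \<Sum>i\<in>UNIV. f \<alpha> k i) = (\<Sum>\<alpha>\<in>{1..N}. \<Sum>i\<in>UNIV. \<Sum>k\<in>{1..m}. f \<alpha> k i)"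
        by (rule sum.cong[OF refl], rule sum.swap)
      also have "\<dots> = (\<Sum>i\<in>UNIV. \<Sum>\<alpha>\<in>{1..N}. \<Sum>k\<in>{1..m}. f \<alpha> k i)" by (rule sum.swap)
      finally show ?thesis .
    qed
    show ?thesis unfolding sum.distrib swap ..
  qed
  also have "\<dots> \<le> (\<Sum>i\<in>(UNIV :: 'n set). 192 * (real N)\<^sup>2 * vbar\<^sup>2) +
      (\<Sum>i\<in>(UNIV :: 'n set). \<Sum>j\<in>(UNIV :: 'n set). 192 * (real N)\<^sup>2 * vbar\<^sup>2)"
    by (intro add_mono sum_mono plane)
  also have "\<dots> = 192 * (CARD('n) + (CARD('n))\<^sup>2) * (real N)\<^sup>2 * vbar\<^sup>2"
    by (simp add: algebra_simps power2_eq_square)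
  finally show ?thesis .
qed

text \<open>The weights are nonnegative, so a bound on all finite partial sums yields both
  summability and the bound on the infinite sum.\<close>

theorem theorem1p1:
  "\<exists>c::real. \<forall>(N::nat) (a::real) (y :: nat \<Rightarrow> real \<Rightarrow> real ^ 'n::finite) (vbar::real).
     N > 0 \<longrightarrow> a > 0 \<longrightarrow>
     hard_sphere_motion N a y \<longrightarrow>
     locally_finite_collisions N a y \<longrightarrow>
     only_binary_collisions N a y \<longrightarrow>
     (\<exists>t>0. vbar = rms_velocity N y t) \<longrightarrow>
     kink_weight vbar y summable_on kinks N a y \<and>
     (\<Sum>\<^sub>\<infinity>k\<in>kinks N a y. kink_weight vbar y k) \<le> c * (real N)\<^sup>2 * vbar\<^sup>2"
proof (intro exI allI impI)
  fix N :: nat and a :: real and y :: "nat \<Rightarrow> real \<Rightarrow> real ^ 'n" and vbar :: real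
  assume "N > 0" "a > 0" and motion: "hard_sphere_motion N a y" "locally_finite_collisions N a y"
    "only_binary_collisions N a y" and "\<exists>t>0. vbar = rms_velocity N y t"
  then obtain t where t: "t > 0" "vbar = rms_velocity N y t" by blast
  define b where "b = 192 * (CARD('n) + (CARD('n))\<^sup>2) * (real N)\<^sup>2 * vbar\<^sup>2"
  have bound: "sum (kink_weight vbar y) F \<le> b" if "finite F" "F \<subseteq> kinks N a y" for F
    unfolding b_def by (rule finite_kink_sum_le[OF \<open>N > 0\<close> motion t that])
  have "vbar \<ge> 0" unfolding t(2) by (rule rms_velocity_nonneg)
  then have sm: "kink_weight vbar y summable_on kinks N a y"
    using bound by (intro nonneg_bdd_above_summable_on kink_weight_nonneg bdd_aboveI2[of _ _ b]) auto
  \<comment> \<open>This fixes the constant as 192 times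
    \<open>CARD('n) + (CARD('n))\<^sup>2\<close>, which depends on the dimension only.\<close>
  show "kink_weight vbar y summable_on kinks N a y \<and>
     (\<Sum>\<^sub>\<infinity>k\<in>kinks N a y. kink_weight vbar y k) \<le> 192 * (CARD('n) + (CARD('n))\<^sup>2) * (real N)\<^sup>2 * vbar\<^sup>2"
    using sm infsum_le_finite_sums[OF sm bound] unfolding b_def by blast
qed

end
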